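(* Let $c>0$, $\alpha>0$ be constants and let $k\ge3$ be a fixed integer. Let $(G_n)$ be a sequence, indexed by an infinite set of positive integers $n$, of $k$-regular simple graphs with $G_n$ having $n$ vertices and girth at least $2\lceil\alpha\log_{k-1}n\rceil+1$. Run the second scheme on $G_n$ with period $\tau=\lfloor c\log n\rfloor$. Then there is a constant $C$ such that, with probability tending to $1$ as $n\to\infty$, the maximum load after all $n$ balls have been placed satisfies $$\max_vQ_v(n)\le\log_2\log n+C.$$
   Context: All logarithms without base are natural. The second scheme on a $k$-regular graph $G=(V,E)$ with $|V|=n$ and integer period $\tau\ge1$: bins are the vertices of $G$. Two walkers $W_1(t),W_2(t)$, $t=0,1,2,\dots$, move on $G$. At each time $t\in\{0,\tau,2\tau,\dots\}$ both walkers are (re)set to independent, uniformly random vertices, independently of the past. Between consecutive reset times, the walkers perform independent non-backtracking random walks: the first step after a reset goes to a uniformly random neighbour, and each later step goes to a uniformly random neighbour of the current vertex other than the vertex occupied at the previous time. Intersections of paths do not cause a reset. Loads: $Q_v(0)=0$ for all $v\in V$. At each time $t=0,1,\dots,n-1$ one ball is added to whichever of the bins $W_1(t),W_2(t)$ has smaller load $Q_v(t)$, ties being broken by an arbitrary non-random rule; this gives $Q(t+1)$. *)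

theory Defs
  imports
    "HOL-Probability.Probability_Mass_Function"
    "HOL-Library.Extended_Nat"
    "Graph_Theory.Pair_Digraph"
begin

text \<open>
  A finite simple graph is a \<^locale>\<open>pair_graph\<close>: a finite, loop-free digraph with symmetric arc
  relation. In such a digraph every edge gives rise to closed walks \<open>u, v, u\<close>, which count as
  directed cycles of length 2; the cycles of the undirected graph are those of length at least 3.
  The girth of a forest is \<open>\<infinity>\<close>.
\<close>

definition girth :: "'a pair_pre_digraph \<Rightarrow> enat" where
  "girth G = (INF p \<in> {p. pre_digraph.cycle (with_proj G) p \<and> length p \<ge> 3}. enat (length p))"

definition regular :: "nat \<Rightarrow> 'a pair_pre_digraph \<Rightarrow> bool" where
  "regular k G \<longleftrightarrow> (\<forall>v \<in> pverts G. out_degree (with_proj G) v = k)"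

definition neighbours :: "'a pair_pre_digraph \<Rightarrow> 'a \<Rightarrow> 'a set" where
  "neighbours G v = {w. (v, w) \<in> parcs G}"

text \<open>
  The history \<open>h\<close> of a walker lists its positions at the times \<open>0, \<dots>, length h - 1\<close>;
  \<open>next_position\<close> is the law of its position at time \<open>length h\<close>.
\<close>

definition next_position :: "'a pair_pre_digraph \<Rightarrow> nat \<Rightarrow> 'a list \<Rightarrow> 'a pmf" where
  "next_position G \<tau> h =
     (let t = length h in
      if t mod \<tau> = 0 then pmf_of_set (pverts G)
      else if t mod \<tau> = 1 then pmf_of_set (neighbours G (h ! (t - 1)))
      else pmf_of_set (neighbours G (h ! (t - 1)) - {h ! (t - 2)}))"

primrec walker :: "'a pair_pre_digraph \<Rightarrow> nat \<Rightarrow> nat \<Rightarrow> 'a list pmf" where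
  "walker G \<tau> 0 = return_pmf []"
| "walker G \<tau> (Suc t) =
     bind_pmf (walker G \<tau> t) (\<lambda>h. map_pmf (\<lambda>v. h @ [v]) (next_position G \<tau> h))"

definition walkers :: "'a pair_pre_digraph \<Rightarrow> nat \<Rightarrow> nat \<Rightarrow> ('a list \<times> 'a list) pmf" where
  "walkers G \<tau> T = pair_pmf (walker G \<tau> T) (walker G \<tau> T)"

text \<open>
  A tie-breaking rule is a deterministic function of the two histories up to and including the
  present time (these determine the time and all loads); \<open>True\<close> selects the first walker's bin.
\<close>

type_synonym 'a tie_rule = "'a list \<Rightarrow> 'a list \<Rightarrow> bool"

definition chosen_bin ::
    "'a tie_rule \<Rightarrow> 'a list \<Rightarrow> 'a list \<Rightarrow> nat \<Rightarrow> ('a \<Rightarrow> nat) \<Rightarrow> 'a" where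
  "chosen_bin tie w1 w2 t Q =
     (if Q (w1 ! t) < Q (w2 ! t) then w1 ! t
      else if Q (w2 ! t) < Q (w1 ! t) then w2 ! t
      else if tie (take (Suc t) w1) (take (Suc t) w2) then w1 ! t
      else w2 ! t)"

primrec load :: "'a tie_rule \<Rightarrow> 'a list \<Rightarrow> 'a list \<Rightarrow> nat \<Rightarrow> 'a \<Rightarrow> nat" where
  "load tie w1 w2 0 = (\<lambda>v. 0)"
| "load tie w1 w2 (Suc t) =
     (let Q = load tie w1 w2 t; b = chosen_bin tie w1 w2 t Q in Q(b := Q b + 1))"

definition max_load ::
    "'a pair_pre_digraph \<Rightarrow> 'a tie_rule \<Rightarrow> 'a list \<Rightarrow> 'a list \<Rightarrow> nat \<Rightarrow> nat" where
  "max_load G tie w1 w2 t = Max (load tie w1 w2 t ` pverts G)"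

end

theory Submission
  imports Defs "HOL-Real_Asymp.Real_Asymp"
begin

text \<open>
  Call the \<open>\<tau>\<close> steps between two resets an epoch. Given the past up to the start of an epoch, each
  walker is uniformly distributed at every time of the epoch, because a non-backtracking walk started
  at a uniform vertex of a regular graph is stationary. Hence both walkers sit at bins that had load
  at least \<open>i\<close> at the start of the epoch with probability \<open>(\<nu>\<^sub>i / n)\<^sup>2\<close>, as in the classical
  two-choice process; the epochs being independent, an exponential moment bound controls the number of
  such times. A bin can have gained load within the epoch only if it was visited earlier in the epoch.
  By the girth assumption this has probability at most a power of \<open>1 / n\<close>, so the recursion
  \<open>\<nu>\<^sub>i\<^sub>+\<^sub>1 \<le> 8 \<nu>\<^sub>i\<^sup>2 / n + n\<^sup>1\<^sup>-\<^sup>d\<close> holds with overwhelming probability and reaches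
  \<open>\<nu>\<^sub>i \<le> 4 n\<^sup>1\<^sup>-\<^sup>d\<close> at \<open>i = log\<^sub>2 log n + O(1)\<close>. From there on it suffices that a bin is
  visited at most a constant number \<open>J\<close> of times in an epoch, again by the girth assumption: a bin of
  load \<open>i + J\<close> then had load \<open>i\<close> at the start of the epoch, so that \<open>\<nu>\<close> is squared at a cost of \<open>J\<close>
  levels without any collision term, and boundedly many squarings bring it to \<open>0\<close>.
\<close>

text \<open>Since all fibres have the same size \<open>c\<close>, the two-stage draw gives every
  pair the mass \<open>1 / (card A * c)\<close>. Applied step by step, this makes a non-backtracking
  walk uniform over all walks of its length.\<close>

lemma pmf_of_set_Sigma:
  assumes "finite A" "A \<noteq> {}" "\<And>h. h \<in> A \<Longrightarrow> finite (B h)" "\<And>h. h \<in> A \<Longrightarrow> card (B h) = c" "c > 0"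
  shows "bind_pmf (pmf_of_set A) (\<lambda>h. map_pmf (Pair h) (pmf_of_set (B h))) = pmf_of_set (Sigma A B)"
proof (rule pmf_eqI)
  fix x :: "'a \<times> 'b"
  obtain h v where x: "x = (h, v)" by fastforce
  have ne: "B h' \<noteq> {}" if "h' \<in> A" for h' using assms(4)[OF that] assms(5) by auto
  obtain h0 where h0: "h0 \<in> A" using assms(2) by auto
  have Sne: "Sigma A B \<noteq> {}" using h0 ne[OF h0] by blast
  have Sfin: "finite (Sigma A B)" using assms(1,3) by auto
  have cS: "card (Sigma A B) = card A * c" using assms by (simp add: card_SigmaI)
  have "pmf (bind_pmf (pmf_of_set A) (\<lambda>h. map_pmf (Pair h) (pmf_of_set (B h)))) x
      = (\<Sum>h'\<in>A. pmf (map_pmf (Pair h') (pmf_of_set (B h'))) x) / card A"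
    using assms by (subst pmf_bind_pmf_of_set) auto
  also have "(\<Sum>h'\<in>A. pmf (map_pmf (Pair h') (pmf_of_set (B h'))) x)
      = (\<Sum>h'\<in>A. if h' = h then pmf (pmf_of_set (B h)) v else 0)"
    by (intro sum.cong refl) (auto simp: x pmf_map_inj' inj_on_def intro!: pmf_map_outside)
  also have "\<dots> = (if h \<in> A then indicator (B h) v / c else 0)"
    using assms ne by (auto simp: sum.delta)
  finally show "pmf (bind_pmf (pmf_of_set A) (\<lambda>h. map_pmf (Pair h) (pmf_of_set (B h)))) x
      = pmf (pmf_of_set (Sigma A B)) x"
    using Sne Sfin by (auto simp: cS x indicator_def)
qed

section \<open>Non-backtracking walks in graphs of large girth\<close>

locale regular_girth_graph = pair_graph G for G :: "'a pair_pre_digraph" +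
  fixes k g :: nat
  assumes degree_ge_3: "3 \<le> k" and regular: "regular k G"
    and girth_ge: "enat (2 * g + 1) \<le> girth G" and verts_nonempty: "pverts G \<noteq> {}"
begin

abbreviation order :: nat where "order \<equiv> card (pverts G)"

lemma order_pos: "order > 0"
  using verts_nonempty pair_finite_verts by (simp add: card_gt_0_iff)

lemma finite_neighbours: "finite (neighbours G v)"
  by (rule finite_subset[of _ "snd ` parcs G"]) (force simp: neighbours_def pair_finite_arcs)+

lemma card_neighbours:
  assumes "v \<in> pverts G" shows "card (neighbours G v) = k"
proof -
  have "out_arcs (with_proj G) v = Pair v ` neighbours G v"
    by (auto simp: out_arcs_def neighbours_def)
  then have "card (out_arcs (with_proj G) v) = card (neighbours G v)"
    by (simp add: card_image inj_on_def)
  then show ?thesis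
    using regular assms by (simp add: regular_def out_degree_def)
qed

lemma arc_sym: "(u, v) \<in> parcs G \<Longrightarrow> (v, u) \<in> parcs G"
  using pair_sym_arcs by (simp add: symmetric_def sym_def)

definition nb_walk :: "'a list \<Rightarrow> bool" where
  "nb_walk h \<longleftrightarrow> set h \<subseteq> pverts G \<and> (\<forall>i. Suc i < length h \<longrightarrow> (h ! i, h ! Suc i) \<in> parcs G) \<and>
     (\<forall>i. Suc (Suc i) < length h \<longrightarrow> h ! i \<noteq> h ! Suc (Suc i))"

text \<open>Walks are handled as vertex lists, cycles as arc lists; the arcs of the segment of
  \<open>h\<close> between the indices \<open>i\<close> and \<open>j\<close> link the two
  views.\<close>

lemma pcas_map_nth:
  "i \<le> j \<Longrightarrow> pcas (h ! i) (map (\<lambda>r. (h ! r, h ! Suc r)) [i..<j]) (h ! j)"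
  by (induction i rule: inc_induct) (auto simp: upt_conv_Cons)

lemma pawalk_verts_map_nth:
  "i \<le> j \<Longrightarrow> pawalk_verts (h ! i) (map (\<lambda>r. (h ! r, h ! Suc r)) [i..<j]) = map ((!) h) [i..<Suc j]"
  by (induction i rule: inc_induct) (auto simp: upt_conv_Cons simp del: upt_Suc)

text \<open>A closed segment of minimal length has no inner repetition and hence is a cycle.
  Loop-freeness and the non-backtracking condition rule out lengths 1 and 2, so the girth bound
  applies. A turn back at the closing vertex is allowed, which lets two walks be glued there in
  \<open>nb_walk_unique\<close>.\<close>

lemma closed_nb_walk_length:
  assumes "nb_walk h" "i < j" "j < length h" "h ! i = h ! j"
  shows "2 * g + 1 \<le> j - i"
  using assms(2-4)
proof (induction "j - i" arbitrary: i j rule: less_induct)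
  case less
  show ?case
  proof (cases "\<exists>i' j'. i \<le> i' \<and> i' < j' \<and> j' \<le> j \<and> j' - i' < j - i \<and> h ! i' = h ! j'")
    case True
    then obtain i' j' where *: "i \<le> i'" "i' < j'" "j' \<le> j" "j' - i' < j - i" "h ! i' = h ! j'"
      by blast
    have "2 * g + 1 \<le> j' - i'"
      using less.hyps[of j' i'] * less.prems by simp
    then show ?thesis using * by simp
  next
    case False
    let ?p = "map (\<lambda>r. (h ! r, h ! Suc r)) [i..<j]"
    have arcs: "(h ! r, h ! Suc r) \<in> parcs G" if "r < j" for r
      using assms(1) less.prems that by (auto simp: nb_walk_def)
    have "h ! i \<in> pverts G"
      using assms(1) less.prems by (auto simp: nb_walk_def subset_iff)
    then have "awalk (h ! i) ?p (h ! i)"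
      using pcas_map_nth[of i j h] less.prems arcs by (auto simp: awalk_def)
    moreover have "distinct (tl (pawalk_verts (h ! i) ?p))"
    proof -
      have "inj_on ((!) h) {Suc i..<Suc j}"
      proof (rule linorder_inj_onI)
        fix a b assume ab: "a < b" "a \<in> {Suc i..<Suc j}" "b \<in> {Suc i..<Suc j}"
        then have "i \<le> a \<and> a < b \<and> b \<le> j \<and> b - a < j - i" by auto
        then show "h ! a \<noteq> h ! b" using False by blast
      qed auto
      moreover have "tl (pawalk_verts (h ! i) ?p) = map ((!) h) [Suc i..<Suc j]"
        using pawalk_verts_map_nth[of i j h] less.prems(1)
        by (simp add: upt_conv_Cons del: upt_Suc)
      ultimately show ?thesis by (simp add: distinct_map del: upt_Suc)
    qed
    ultimately have "cycle ?p"
      using less.prems(1) by (auto simp: cycle_def)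
    moreover have "length ?p \<ge> 3"
    proof -
      have "j \<noteq> Suc i" using arcs[of i] less.prems pair_no_loops[of "(h ! i, h ! Suc i)"] by auto
      moreover have "j \<noteq> Suc (Suc i)" using assms(1) less.prems by (auto simp: nb_walk_def)
      ultimately show ?thesis using less.prems by simp
    qed
    ultimately have "girth G \<le> enat (length ?p)"
      unfolding girth_def by (intro INF_lower) auto
    then have "enat (2 * g + 1) \<le> enat (length ?p)" using girth_ge by (rule order_trans[rotated])
    then show ?thesis by simp
  qed
qed

text \<open>Two different walks of length \<open>m\<close> with common ends would close up, after deletion of their
  common final segment, to a non-backtracking walk of length at most \<open>2 m\<close>.\<close>

lemma nb_walk_unique:
  assumes "nb_walk p" "nb_walk q" "length p = Suc m" "length q = Suc m" "m \<le> g"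
    and "p ! 0 = q ! 0" "p ! m = q ! m"
  shows "p = q"
  using assms
proof (induction m arbitrary: p q)
  case 0
  then show ?case by (auto simp: length_Suc_conv)
next
  case (Suc m)
  show ?case
  proof (cases "p ! m = q ! m")
    case True
    have "nb_walk (take (Suc m) p)" "nb_walk (take (Suc m) q)"
      using Suc.prems(1,2) by (auto simp: nb_walk_def dest: in_set_takeD)
    then have "take (Suc m) p = take (Suc m) q"
      using Suc.prems True by (intro Suc.IH) auto
    moreover have "p = take (Suc m) p @ [p ! Suc m]" "q = take (Suc m) q @ [q ! Suc m]"
      using Suc.prems(3,4) by (metis lessI take_Suc_conv_app_nth take_all order_refl)+
    ultimately show ?thesis using Suc.prems(7) by metis
  next
    case False
    \<comment> \<open>\<open>f\<close> follows \<open>p\<close> up to the common end at index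
      \<open>Suc m\<close> and then \<open>q\<close> backwards, reaching the start again at index
      \<open>2 * m + 2\<close>.\<close>
    define f where "f i = (if i \<le> Suc m then p ! i else q ! (2 * m + 2 - i))" for i
    define w where "w = map f [0..<2 * m + 3]"
    have len: "length w = 2 * m + 3" by (simp add: w_def)
    have wn: "w ! i = f i" if "i < 2 * m + 3" for i using that by (simp add: w_def)
    have f2: "f i = q ! (2 * m + 2 - i)" if "Suc m \<le> i" for i
      using that Suc.prems(7) by (cases "i = Suc m") (auto simp: f_def)
    have "nb_walk w"
      unfolding nb_walk_def
    proof (intro conjI allI impI)
      show "set w \<subseteq> pverts G"
        using Suc.prems(1-4) by (auto simp: w_def f_def nb_walk_def subset_iff)
    next
      fix i assume i: "Suc i < length w"
      show "(w ! i, w ! Suc i) \<in> parcs G"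
      proof (cases "i \<le> m")
        case True
        then show ?thesis using i Suc.prems(1,3) by (simp add: len wn f_def nb_walk_def)
      next
        case False
        have "Suc (2 * m + 1 - i) < length q"
          using Suc.prems(4) False by linarith
        then have "(q ! (2 * m + 1 - i), q ! Suc (2 * m + 1 - i)) \<in> parcs G"
          using Suc.prems(2) by (simp add: nb_walk_def)
        moreover have "Suc (2 * m + 1 - i) = 2 * m + 2 - i" "2 * m + 1 - i = 2 * m + 2 - Suc i"
          using i len by auto
        ultimately have "(q ! (2 * m + 2 - Suc i), q ! (2 * m + 2 - i)) \<in> parcs G" by metis
        then show ?thesis using False i by (auto simp: len wn f2 intro: arc_sym)
      qed
    next
      fix i assume i: "Suc (Suc i) < length w"
      consider "i < m" | "i = m" | "i > m" by linarith
      then show "w ! i \<noteq> w ! Suc (Suc i)"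
      proof cases
        case 1
        then show ?thesis using i Suc.prems(1,3) by (simp add: len wn f_def nb_walk_def)
      next
        case 2
        \<comment> \<open>The turn at the common end: the vertices before and after it are
          \<open>p ! m\<close> and \<open>q ! m\<close>, distinct by the case assumption.\<close>
        have "2 * m + 2 - Suc (Suc m) = m" by simp
        then show ?thesis using i \<open>p ! m \<noteq> q ! m\<close> unfolding 2 by (simp add: len wn f_def)
      next
        case 3
        have "Suc (Suc (2 * m - i)) < length q"
          using Suc.prems(4) 3 i len by linarith
        then have "q ! (2 * m - i) \<noteq> q ! Suc (Suc (2 * m - i))"
          using Suc.prems(2) by (simp add: nb_walk_def)
        moreover have "Suc (Suc (2 * m - i)) = 2 * m + 2 - i" "2 * m - i = 2 * m + 2 - Suc (Suc i)"
          using i len by auto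
        ultimately have "q ! (2 * m + 2 - Suc (Suc i)) \<noteq> q ! (2 * m + 2 - i)" by metis
        then show ?thesis using 3 i by (simp add: len wn f2)
      qed
    qed
    moreover have "w ! 0 = w ! (2 * m + 2)"
      using Suc.prems(6) by (simp add: wn f_def)
    ultimately have "2 * g + 1 \<le> 2 * m + 2 - 0"
      by (intro closed_nb_walk_length) (auto simp: len)
    then show ?thesis using Suc.prems(5) by simp
  qed
qed

end

section \<open>Counting non-backtracking walks\<close>

context regular_girth_graph
begin

text \<open>The possible next positions inside an epoch whose positions so far are \<open>h\<close>,
  so that \<open>length h\<close> is the time since the reset.\<close>

definition extensions :: "'a list \<Rightarrow> 'a set" where
  "extensions h = (if h = [] then pverts G
     else if length h = 1 then neighbours G (last h)
     else neighbours G (last h) - {h ! (length h - 2)})"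

definition nb_walks :: "nat \<Rightarrow> 'a list set" where
  "nb_walks L = {h. length h = L \<and> nb_walk h}"

definition nb_walks_from :: "'a \<Rightarrow> nat \<Rightarrow> 'a list set" where
  "nb_walks_from y L = {h. length h = L \<and> nb_walk h \<and> h ! 0 = y}"

text \<open>The number of non-backtracking walks of \<open>L\<close> steps, hence
  \<open>L + 1\<close> vertices, from any fixed vertex: \<open>k\<close> choices for the first step,
  \<open>k - 1\<close> for each later one.\<close>

primrec count_from :: "nat \<Rightarrow> nat" where
  "count_from 0 = 1"
| "count_from (Suc L) = (if L = 0 then k else (k - 1) * count_from L)"

lemma nb_walks_finite [simp]: "finite (nb_walks L)"
  by (rule finite_subset[OF _ finite_lists_length_eq[OF pair_finite_verts, of L]])
    (auto simp: nb_walks_def nb_walk_def)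

lemma nb_walks_from_subset: "nb_walks_from y L \<subseteq> nb_walks L"
  by (auto simp: nb_walks_from_def nb_walks_def)

lemma finite_extensions: "finite (extensions h)"
  by (simp add: extensions_def finite_neighbours pair_finite_verts)

lemma nb_walk_snoc:
  assumes "length h = L" shows "nb_walk (h @ [v]) \<longleftrightarrow> nb_walk h \<and> v \<in> extensions h"
proof -
  consider "L = 0" | "L = 1" | m where "L = Suc (Suc m)"
    by (metis One_nat_def not0_implies_Suc)
  then show ?thesis
  proof cases
    case 1
    then show ?thesis using assms by (auto simp: nb_walk_def extensions_def)
  next
    case 2
    then obtain x where "h = [x]" using assms by (auto simp: length_Suc_conv)
    then show ?thesis
      using in_arcsD2 by (auto simp: nb_walk_def extensions_def neighbours_def)
  next
    case (3 m)
    have "h \<noteq> []" using 3 assms by auto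
    then have lasth: "last h = h ! Suc m" "h \<noteq> []" using 3 assms by (auto simp: last_conv_nth)
    show ?thesis
    proof
      assume nb: "nb_walk (h @ [v])"
      have a: "((h @ [v]) ! i, (h @ [v]) ! Suc i) \<in> parcs G" if "Suc i < L + 1" for i
        using nb assms that by (auto simp: nb_walk_def)
      have b: "(h @ [v]) ! i \<noteq> (h @ [v]) ! Suc (Suc i)" if "Suc (Suc i) < L + 1" for i
        using nb assms that by (auto simp: nb_walk_def)
      have "nb_walk h"
        unfolding nb_walk_def
      proof (intro conjI allI impI)
        show "set h \<subseteq> pverts G" using nb by (auto simp: nb_walk_def)
        show "(h ! i, h ! Suc i) \<in> parcs G" if "Suc i < length h" for i
          using a[of i] that assms by (simp add: nth_append)
        show "h ! i \<noteq> h ! Suc (Suc i)" if "Suc (Suc i) < length h" for i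
          using b[of i] that assms by (simp add: nth_append)
      qed
      moreover have "v \<in> extensions h"
        using a[of "Suc m"] b[of m] 3 assms lasth
        by (auto simp: extensions_def neighbours_def nth_append)
      ultimately show "nb_walk h \<and> v \<in> extensions h" ..
    next
      assume *: "nb_walk h \<and> v \<in> extensions h"
      then have v: "(h ! Suc m, v) \<in> parcs G" "v \<noteq> h ! m"
        using 3 assms lasth by (auto simp: extensions_def neighbours_def)
      show "nb_walk (h @ [v])"
        unfolding nb_walk_def
      proof (intro conjI allI impI)
        show "set (h @ [v]) \<subseteq> pverts G"
          using * in_arcsD2[OF v(1)] by (auto simp: nb_walk_def)
        show "((h @ [v]) ! i, (h @ [v]) ! Suc i) \<in> parcs G" if "Suc i < length (h @ [v])" for i
        proof (cases "i = Suc m")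
          case False
          then show ?thesis using * that 3 assms by (auto simp: nth_append nb_walk_def)
        qed (use v assms 3 in \<open>auto simp: nth_append\<close>)
        show "(h @ [v]) ! i \<noteq> (h @ [v]) ! Suc (Suc i)" if "Suc (Suc i) < length (h @ [v])" for i
        proof (cases "i = m")
          case False
          then show ?thesis using * that 3 assms by (auto simp: nth_append nb_walk_def)
        qed (use v assms 3 in \<open>auto simp: nth_append\<close>)
      qed
    qed
  qed
qed

text \<open>By symmetry of the arcs the forbidden previous vertex is a neighbour of the last one, so
  its removal leaves exactly \<open>k - 1\<close> choices. That the number depends on
  \<open>length h\<close> alone is what makes the walk uniform.\<close>

lemma card_extensions:
  assumes "nb_walk h"
  shows "card (extensions h) = (if h = [] then order else if length h = 1 then k else k - 1)"
proof -
  have last: "last h \<in> pverts G" if "h \<noteq> []"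
    using assms that by (auto simp: nb_walk_def)
  have "card (extensions h) = k - 1" if "length h \<ge> 2"
  proof -
    define m where "m = length h - 2"
    then have m: "length h = Suc (Suc m)" using that by simp
    then have "h \<noteq> []" by auto
    have lasth: "last h = h ! Suc m" using m \<open>h \<noteq> []\<close> by (simp add: last_conv_nth)
    have "(h ! m, h ! Suc m) \<in> parcs G" using assms m by (simp add: nb_walk_def)
    then have "h ! m \<in> neighbours G (last h)"
      unfolding lasth neighbours_def by (simp add: arc_sym)
    then show ?thesis
      using \<open>h \<noteq> []\<close>
      using m last by (simp add: extensions_def card_Diff_singleton card_neighbours finite_neighbours)
  qed
  moreover have "length h \<ge> 2" if "h \<noteq> []" "length h \<noteq> 1"
    using that by (cases h) (auto simp: Suc_le_eq)
  ultimately show ?thesis using last by (auto simp: extensions_def card_neighbours)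
qed

lemma nb_walks_Suc: "nb_walks (Suc L) = (\<lambda>(h, v). h @ [v]) ` Sigma (nb_walks L) extensions"
proof (intro equalityI subsetI)
  fix w assume w: "w \<in> nb_walks (Suc L)"
  then obtain h v where hv: "w = h @ [v]" "length h = L"
    by (auto simp: nb_walks_def length_Suc_conv_rev)
  then show "w \<in> (\<lambda>(h, v). h @ [v]) ` Sigma (nb_walks L) extensions"
    using w nb_walk_snoc[of h L v] by (auto simp: nb_walks_def)
qed (auto simp: nb_walks_def nb_walk_snoc)

lemma nb_walks_from_Suc:
  assumes "L > 0"
  shows "nb_walks_from y (Suc L) = (\<lambda>(h, v). h @ [v]) ` Sigma (nb_walks_from y L) extensions"
proof (intro equalityI subsetI)
  fix w assume w: "w \<in> nb_walks_from y (Suc L)"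
  then obtain h v where hv: "w = h @ [v]" "length h = L"
    by (auto simp: nb_walks_from_def length_Suc_conv_rev)
  then show "w \<in> (\<lambda>(h, v). h @ [v]) ` Sigma (nb_walks_from y L) extensions"
    using w nb_walk_snoc[of h L v] assms by (auto simp: nb_walks_from_def nth_append)
qed (use assms in \<open>auto simp: nb_walks_from_def nb_walk_snoc nth_append\<close>)

lemma inj_on_snoc: "inj_on (\<lambda>(h, v). h @ [v]) A"
  by (auto simp: inj_on_def)

lemma card_nb_walks_from:
  assumes "y \<in> pverts G"
  shows "card (nb_walks_from y (Suc L)) = count_from L"
proof (induction L)
  case 0
  have "nb_walks_from y (Suc 0) = {[y]}"
    using assms by (auto simp: nb_walks_from_def nb_walk_def length_Suc_conv)
  then show ?case by simp
next
  case (Suc L)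
  have "card (nb_walks_from y (Suc (Suc L))) = (\<Sum>h\<in>nb_walks_from y (Suc L). card (extensions h))"
    using finite_subset[OF nb_walks_from_subset nb_walks_finite]
    by (simp add: nb_walks_from_Suc card_image[OF inj_on_snoc] card_SigmaI finite_extensions)
  also have "\<dots> = (\<Sum>h\<in>nb_walks_from y (Suc L). if L = 0 then k else k - 1)"
    by (intro sum.cong refl) (auto simp: nb_walks_from_def card_extensions)
  finally show ?case using Suc by simp
qed

lemma card_nb_walks: "card (nb_walks (Suc L)) = order * count_from L"
proof -
  have "nb_walks (Suc L) = (\<Union>y\<in>pverts G. nb_walks_from y (Suc L))"
    by (auto simp: nb_walks_def nb_walks_from_def nb_walk_def subset_iff)
  moreover have "card (\<Union>y\<in>pverts G. nb_walks_from y (Suc L))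
      = (\<Sum>y\<in>pverts G. card (nb_walks_from y (Suc L)))"
    using finite_subset[OF nb_walks_from_subset nb_walks_finite] pair_finite_verts
    by (intro card_UN_disjoint) (auto simp: nb_walks_from_def)
  ultimately show ?thesis by (simp add: card_nb_walks_from)
qed

lemma count_from_pos: "count_from L > 0"
  using degree_ge_3 by (induction L) auto

lemma nb_walks_nonempty: "nb_walks L \<noteq> {}"
proof (cases L)
  case 0
  then show ?thesis by (auto simp: nb_walks_def nb_walk_def)
next
  case (Suc m)
  then show ?thesis
    using card_nb_walks[of m] order_pos count_from_pos[of m] by (intro notI) simp
qed

text \<open>The exceptional first step, with \<open>k\<close> choices, is accounted for in
  \<open>count_from j\<close> when \<open>j > 0\<close>.\<close>

lemma count_from_add: "j > 0 \<Longrightarrow> count_from (j + m) = (k - 1) ^ m * count_from j"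
  by (induction m) auto

lemma nb_walk_rev:
  assumes "nb_walk h" shows "nb_walk (rev h)"
  unfolding nb_walk_def
proof (intro conjI allI impI)
  show "set (rev h) \<subseteq> pverts G" using assms by (simp add: nb_walk_def)
  fix i
  show "(rev h ! i, rev h ! Suc i) \<in> parcs G" if i: "Suc i < length (rev h)"
  proof -
    have "(h ! (length h - Suc (Suc i)), h ! Suc (length h - Suc (Suc i))) \<in> parcs G"
      using assms i unfolding nb_walk_def by (metis Suc_diff_Suc diff_less length_rev less_SucI
          not_less_eq zero_less_Suc Suc_less_eq length_greater_0_conv list.size(3) not_less_zero)
    moreover have "Suc (length h - Suc (Suc i)) = length h - Suc i" using i by simp
    ultimately show ?thesis using i by (auto simp: rev_nth intro: arc_sym)
  qed
  show "rev h ! i \<noteq> rev h ! Suc (Suc i)" if i: "Suc (Suc i) < length (rev h)"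
  proof -
    have "Suc (Suc (length h - Suc (Suc (Suc i)))) < length h" using i by simp
    then have "h ! (length h - Suc (Suc (Suc i))) \<noteq> h ! Suc (Suc (length h - Suc (Suc (Suc i))))"
      using assms by (auto simp: nb_walk_def)
    moreover have "Suc (Suc (length h - Suc (Suc (Suc i)))) = length h - Suc i" using i by simp
    ultimately show ?thesis using i by (simp add: rev_nth)
  qed
qed

lemma nb_walk_take: "nb_walk h \<Longrightarrow> nb_walk (take m h)"
  by (auto simp: nb_walk_def dest: in_set_takeD)

lemma nb_walk_drop: "nb_walk h \<Longrightarrow> nb_walk (drop m h)"
  by (auto simp: nb_walk_def dest: in_set_dropD)

text \<open>Reversal turns a prescribed last vertex into a prescribed first one. Against the total
  \<open>order * count_from L\<close> this is the stationarity of the walk.\<close>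

lemma card_nb_walks_end:
  "card {h \<in> nb_walks (Suc L). h ! L = y} \<le> count_from L"
proof (cases "y \<in> pverts G")
  case True
  have "rev ` {h \<in> nb_walks (Suc L). h ! L = y} \<subseteq> nb_walks_from y (Suc L)"
    by (auto simp: nb_walks_def nb_walks_from_def nb_walk_rev rev_nth)
  then have "card (rev ` {h \<in> nb_walks (Suc L). h ! L = y}) \<le> count_from L"
    using card_nb_walks_from[OF True] card_mono[OF finite_subset[OF nb_walks_from_subset nb_walks_finite]]
    by metis
  then show ?thesis by (simp add: card_image)
next
  case False
  then have "{h \<in> nb_walks (Suc L). h ! L = y} = {}"
    by (auto simp: nb_walks_def nb_walk_def subset_iff)
  then show ?thesis by (simp only: card.empty)
qed

text \<open>The last \<open>g\<close> steps of a walk that returns to \<open>h ! i\<close> are determined by the rest.\<close>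

lemma card_nb_walks_return:
  assumes "i < L"
  shows "card {h \<in> nb_walks (Suc L). h ! i = h ! L} * (k - 1) ^ g \<le> card (nb_walks (Suc L))"
proof (cases "g < L - i")
  case True
  let ?A = "{h \<in> nb_walks (Suc L). h ! i = h ! L}"
  \<comment> \<open>The walk is cut \<open>g\<close> steps before its end. As \<open>i < m\<close>,
    the kept part contains \<open>h ! i\<close> and so determines the final vertex;
    \<open>nb_walk_unique\<close> then restores the segment in between.\<close>
  define m where "m = L - g"
  have m: "i < m" "L = m + g" using True by (auto simp: m_def)
  have "inj_on (take (Suc m)) ?A"
  proof (rule inj_onI)
    fix p q assume pq: "p \<in> ?A" "q \<in> ?A" "take (Suc m) p = take (Suc m) q"
    then have len: "length p = Suc L" "length q = Suc L" by (auto simp: nb_walks_def)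
    have same: "p ! r = q ! r" if "r \<le> m" for r
      using pq(3) that by (metis le_imp_less_Suc nth_take)
    have "drop m p = drop m q"
    proof (rule nb_walk_unique[where m = g])
      show "nb_walk (drop m p)" "nb_walk (drop m q)"
        using pq by (auto simp: nb_walks_def intro: nb_walk_drop)
      show "drop m p ! 0 = drop m q ! 0" using same[of m] len m by simp
      have "p ! L = q ! L" using pq(1,2) same[of i] m by auto
      then show "drop m p ! g = drop m q ! g" using len m by simp
    qed (use len m in auto)
    moreover have "take m p = take m q"
      using pq(3) by (metis min.absorb1 take_take lessI less_imp_le_nat)
    ultimately show "p = q" by (metis append_take_drop_id)
  qed
  moreover have "take (Suc m) ` ?A \<subseteq> nb_walks (Suc m)"
    using m by (auto simp: nb_walks_def nb_walk_take)
  ultimately have "card ?A \<le> card (nb_walks (Suc m))"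
    by (intro card_inj_on_le nb_walks_finite)
  moreover have "card (nb_walks (Suc L)) = (k - 1) ^ g * card (nb_walks (Suc m))"
    using m count_from_add[of m g] by (simp add: card_nb_walks)
  ultimately show ?thesis by simp
next
  case False
  \<comment> \<open>A return within at most \<open>g\<close> steps would contradict the
    girth.\<close>
  have "h ! i \<noteq> h ! L" if "h \<in> nb_walks (Suc L)" for h
  proof
    assume "h ! i = h ! L"
    then have "2 * g + 1 \<le> L - i"
      using that assms by (intro closed_nb_walk_length[of h]) (auto simp: nb_walks_def)
    then show False using False by simp
  qed
  then have "{h \<in> nb_walks (Suc L). h ! i = h ! L} = {}" by blast
  then show ?thesis by (simp only: card.empty)
qed

end

section \<open>Laws of the walkers and independence of the epochs\<close>

lemma length_walker: "h \<in> set_pmf (walker G \<tau> t) \<Longrightarrow> length h = t"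
  by (induction t arbitrary: h) auto

lemma length_walkers: "(h1, h2) \<in> set_pmf (walkers G \<tau> t) \<Longrightarrow> length h1 = t \<and> length h2 = t"
  by (auto simp: walkers_def length_walker)

lemma map_take_walker:
  assumes "m \<le> t" shows "map_pmf (take m) (walker G \<tau> t) = walker G \<tau> m"
  using assms
proof (induction t rule: dec_induct)
  case base
  have "map_pmf (take m) (walker G \<tau> m) = map_pmf (\<lambda>h. h) (walker G \<tau> m)"
    by (intro map_pmf_cong refl) (simp add: length_walker)
  then show ?case by simp
next
  case (step t)
  have "map_pmf (take m) (walker G \<tau> (Suc t))
      = bind_pmf (walker G \<tau> t) (\<lambda>h. map_pmf (\<lambda>v. take m (h @ [v])) (next_position G \<tau> h))"
    by (simp add: map_bind_pmf pmf.map_comp comp_def)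
  also have "\<dots> = bind_pmf (walker G \<tau> t) (\<lambda>h. return_pmf (take m h))"
    using step.hyps by (intro bind_pmf_cong refl) (simp add: length_walker)
  also have "\<dots> = walker G \<tau> m"
    using step.IH by (simp add: map_pmf_def)
  finally show ?case .
qed

lemma map_take_walkers:
  assumes "m \<le> t"
  shows "map_pmf (map_prod (take m) (take m)) (walkers G \<tau> t) = walkers G \<tau> m"
  using map_pair[of "take m" "take m" "walker G \<tau> t" "walker G \<tau> t"] map_take_walker[OF assms, of G \<tau>]
  by (simp add: walkers_def map_prod_def)

text \<open>\<open>next_position\<close> reads the time modulo \<open>\<tau>\<close> and looks back
  only at positions after the last reset, all of which lie in \<open>e\<close>.\<close>

lemma next_position_append:
  assumes "length h = s * \<tau>" "length e < \<tau>"
  shows "next_position G \<tau> (h @ e) = next_position G \<tau> e"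
proof -
  have mod: "length (h @ e) mod \<tau> = length e" "length e mod \<tau> = length e" using assms by simp_all
  consider "e = []" | v where "e = [v]" | m where "length e = Suc (Suc m)"
    by (metis length_0_conv length_Suc_conv not0_implies_Suc)
  then show ?thesis
  proof cases
    case (3 m)
    then show ?thesis using mod unfolding next_position_def Let_def by (simp add: nth_append)
  qed (use mod in \<open>simp_all add: next_position_def Let_def\<close>)
qed

text \<open>A reset makes each epoch a fresh copy of the first one, independent of the history; the
  bounds over many epochs rest on this.\<close>

lemma walker_append:
  assumes "r \<le> \<tau>"
  shows "walker G \<tau> (s * \<tau> + r)
    = bind_pmf (walker G \<tau> (s * \<tau>)) (\<lambda>h. map_pmf (\<lambda>e. h @ e) (walker G \<tau> r))"
  using assms
proof (induction r)
  case 0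
  then show ?case by (simp add: bind_return_pmf')
next
  case (Suc r)
  have "walker G \<tau> (s * \<tau> + Suc r)
      = bind_pmf (walker G \<tau> (s * \<tau>)) (\<lambda>h. bind_pmf (walker G \<tau> r)
          (\<lambda>e. map_pmf (\<lambda>v. (h @ e) @ [v]) (next_position G \<tau> (h @ e))))"
    using Suc by (simp add: bind_assoc_pmf bind_map_pmf)
  also have "\<dots> = bind_pmf (walker G \<tau> (s * \<tau>)) (\<lambda>h. bind_pmf (walker G \<tau> r)
          (\<lambda>e. map_pmf (\<lambda>v. h @ (e @ [v])) (next_position G \<tau> e)))"
  proof (intro bind_pmf_cong refl)
    fix h e assume "h \<in> set_pmf (walker G \<tau> (s * \<tau>))" "e \<in> set_pmf (walker G \<tau> r)"
    then show "map_pmf (\<lambda>v. (h @ e) @ [v]) (next_position G \<tau> (h @ e))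
        = map_pmf (\<lambda>v. h @ (e @ [v])) (next_position G \<tau> e)"
      using Suc.prems by (simp add: length_walker next_position_append[where s = s])
  qed
  finally show ?case by (simp add: map_bind_pmf pmf.map_comp comp_def)
qed

lemma walkers_append:
  "walkers G \<tau> (Suc s * \<tau>)
    = bind_pmf (walkers G \<tau> (s * \<tau>))
        (\<lambda>(h1, h2). map_pmf (\<lambda>(e1, e2). (h1 @ e1, h2 @ e2)) (walkers G \<tau> \<tau>))"
proof -
  have "walkers G \<tau> (Suc s * \<tau>) = bind_pmf (walker G \<tau> (s * \<tau>)) (\<lambda>h1. bind_pmf (walker G \<tau> \<tau>) (\<lambda>e1.
      bind_pmf (walker G \<tau> (s * \<tau>)) (\<lambda>h2. bind_pmf (walker G \<tau> \<tau>) (\<lambda>e2.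
      return_pmf (h1 @ e1, h2 @ e2)))))"
    using walker_append[of \<tau> \<tau> G s]
    by (simp add: walkers_def pair_pmf_def add.commute bind_assoc_pmf bind_map_pmf)
  \<comment> \<open>The walkers are independent, so the draw of \<open>e1\<close> may be postponed
    until both histories are known.\<close>
  also have "\<dots> = bind_pmf (walker G \<tau> (s * \<tau>)) (\<lambda>h1. bind_pmf (walker G \<tau> (s * \<tau>)) (\<lambda>h2.
      bind_pmf (walker G \<tau> \<tau>) (\<lambda>e1. bind_pmf (walker G \<tau> \<tau>) (\<lambda>e2.
      return_pmf (h1 @ e1, h2 @ e2)))))"
    by (intro bind_pmf_cong refl bind_commute_pmf)
  finally show ?thesis
    by (simp add: walkers_def pair_pmf_def map_pmf_def bind_assoc_pmf bind_return_pmf)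
qed

text \<open>\<open>R h1 h2 j e1 e2\<close> judges the offset \<open>j\<close> of an epoch from the
  histories \<open>h1\<close>, \<open>h2\<close> before it and the trajectories \<open>e1\<close>,
  \<open>e2\<close> within it. Keeping the two apart allows the history to be fixed while the epoch
  is averaged over.\<close>

definition at_epoch ::
    "('a list \<Rightarrow> 'a list \<Rightarrow> nat \<Rightarrow> 'a list \<Rightarrow> 'a list \<Rightarrow> bool) \<Rightarrow> nat \<Rightarrow> nat \<Rightarrow> 'a list \<times> 'a list \<Rightarrow> bool"
  where
  "at_epoch R \<tau> t w = (let s = t div \<tau> * \<tau> in
     R (take s (fst w)) (take s (snd w)) (t mod \<tau>)
       (take \<tau> (drop s (fst w))) (take \<tau> (drop s (snd w))))"

definition epoch_count ::
    "('a list \<Rightarrow> 'a list \<Rightarrow> nat \<Rightarrow> 'a list \<Rightarrow> 'a list \<Rightarrow> bool) \<Rightarrow> nat \<Rightarrow> nat \<Rightarrow> 'a list \<times> 'a list \<Rightarrow> nat"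
  where "epoch_count R \<tau> s w = card {t. t < s * \<tau> \<and> at_epoch R \<tau> t w}"

lemma epoch_count_append:
  assumes "length h1 = s * \<tau>" "length h2 = s * \<tau>" "length e1 = \<tau>" "length e2 = \<tau>" "\<tau> > 0"
  shows "epoch_count R \<tau> (Suc s) (h1 @ e1, h2 @ e2)
    = epoch_count R \<tau> s (h1, h2) + card {j. j < \<tau> \<and> R h1 h2 j e1 e2}"
proof -
  let ?w = "(h1 @ e1, h2 @ e2)"
  have old: "at_epoch R \<tau> t ?w \<longleftrightarrow> at_epoch R \<tau> t (h1, h2)" if "t < s * \<tau>" for t
  proof -
    have "t div \<tau> < s" using that assms(5) by (simp add: less_mult_imp_div_less)
    then have "t div \<tau> * \<tau> + \<tau> \<le> s * \<tau>" by (metis Suc_leI add.commute mult_Suc mult_le_mono1)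
    moreover have "t div \<tau> * \<tau> - s * \<tau> = 0" using \<open>t div \<tau> < s\<close> by simp
    ultimately show ?thesis using assms by (simp add: at_epoch_def Let_def)
  qed
  have new: "at_epoch R \<tau> (s * \<tau> + j) ?w \<longleftrightarrow> R h1 h2 j e1 e2" if "j < \<tau>" for j
    using that assms by (simp add: at_epoch_def Let_def)
  have "{t. t < Suc s * \<tau> \<and> at_epoch R \<tau> t ?w}
      = {t. t < s * \<tau> \<and> at_epoch R \<tau> t (h1, h2)} \<union> (\<lambda>j. s * \<tau> + j) ` {j. j < \<tau> \<and> R h1 h2 j e1 e2}"
  proof (intro equalityI subsetI)
    fix t assume t: "t \<in> {t. t < Suc s * \<tau> \<and> at_epoch R \<tau> t ?w}"
    show "t \<in> {t. t < s * \<tau> \<and> at_epoch R \<tau> t (h1, h2)} \<union> (\<lambda>j. s * \<tau> + j) ` {j. j < \<tau> \<and> R h1 h2 j e1 e2}"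
    proof (cases "t < s * \<tau>")
      case True
      then show ?thesis using t old by auto
    next
      case False
      define j where "j = t - s * \<tau>"
      have "t = s * \<tau> + j" "j < \<tau>" using t False by (auto simp: j_def)
      then show ?thesis using t new by blast
    qed
  qed (use old new in auto)
  moreover have "card ({t. t < s * \<tau> \<and> at_epoch R \<tau> t (h1, h2)} \<union> (\<lambda>j. s * \<tau> + j) ` {j. j < \<tau> \<and> R h1 h2 j e1 e2})
     = card {t. t < s * \<tau> \<and> at_epoch R \<tau> t (h1, h2)} + card {j. j < \<tau> \<and> R h1 h2 j e1 e2}"
    by (subst card_Un_disjoint) (auto simp: card_image)
  ultimately show ?thesis by (simp add: epoch_count_def)
qed

section \<open>Exponential moments and tails of counts over epochs\<close>

lemma exp_le_one_plus_two: 
  fixes x :: real assumes "0 \<le> x" "x \<le> 1" shows "exp x \<le> 1 + 2 * x"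
proof -
  have "exp x \<le> 1 + x + x\<^sup>2" using assms by (rule exp_bound)
  moreover have "x\<^sup>2 \<le> x" using assms by (simp add: power2_eq_square mult_left_le)
  ultimately show ?thesis by linarith
qed

text \<open>Times within one epoch are dependent, so only the mean of the number \<open>X\<close> of
  hits in an epoch is used: \<open>X / \<tau>\<close> lies between 0 and 1, where
  \<open>exp x \<le> 1 + 2 * x\<close>, so its exponential has mean at most
  \<open>1 + 2 * p \<le> exp (2 * p)\<close>. As \<open>p\<close> is a bound for every history, the
  factors of successive epochs multiply.\<close>

lemma epoch_count_exp_moment:
  assumes p: "\<And>h1 h2 j. j < \<tau> \<Longrightarrow> measure_pmf.prob (walkers G \<tau> \<tau>) {(e1, e2). R h1 h2 j e1 e2} \<le> p"
    and "\<tau> > 0"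
  shows "(\<integral>\<^sup>+ w. ennreal (exp (real (epoch_count R \<tau> s w) / \<tau>)) \<partial>walkers G \<tau> (s * \<tau>))
    \<le> ennreal (exp (2 * real s * p))"
proof (induction s)
  case 0
  show ?case by (simp add: walkers_def epoch_count_def)
next
  case (Suc s)
  let ?E = "walkers G \<tau> \<tau>"
  have step: "(\<integral>\<^sup>+ w. ennreal (exp (real (epoch_count R \<tau> (Suc s) w) / \<tau>))
        \<partial>map_pmf (\<lambda>(e1, e2). (h1 @ e1, h2 @ e2)) ?E)
      \<le> ennreal (exp (real (epoch_count R \<tau> s (h1, h2)) / \<tau>)) * ennreal (exp (2 * p))"
    if h: "(h1, h2) \<in> set_pmf (walkers G \<tau> (s * \<tau>))" for h1 h2
  proof -
    define X where "X e = (\<Sum>j<\<tau>. indicator {(e1, e2). R h1 h2 j e1 e2} e :: real)" for e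
    have X: "X (e1, e2) = card {j. j < \<tau> \<and> R h1 h2 j e1 e2}" for e1 e2
    proof -
      have "X (e1, e2) = (\<Sum>j<\<tau>. if R h1 h2 j e1 e2 then 1 else 0)"
        unfolding X_def by (intro sum.cong refl) (simp add: indicator_def)
      also have "\<dots> = card {j \<in> {..<\<tau>}. R h1 h2 j e1 e2}"
        by (subst sum.If_cases) (simp_all add: Int_def)
      finally show ?thesis by (simp add: lessThan_def)
    qed
    have X01: "0 \<le> X e \<and> X e \<le> \<tau>" for e
    proof -
      have "X e \<le> (\<Sum>j<\<tau>. 1)" unfolding X_def by (intro sum_mono) (simp add: indicator_def)
      then show ?thesis by (auto simp: X_def intro: sum_nonneg)
    qed
    have "(\<integral>\<^sup>+ w. ennreal (exp (real (epoch_count R \<tau> (Suc s) w) / \<tau>))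
        \<partial>map_pmf (\<lambda>(e1, e2). (h1 @ e1, h2 @ e2)) ?E)
      = (\<integral>\<^sup>+ e. ennreal (exp (real (epoch_count R \<tau> (Suc s) (h1 @ fst e, h2 @ snd e)) / \<tau>)) \<partial>measure_pmf ?E)"
      by (simp add: case_prod_unfold)
    also have "\<dots> \<le> (\<integral>\<^sup>+ e. ennreal (exp (real (epoch_count R \<tau> s (h1, h2)) / \<tau>))
        * ennreal (1 + 2 / real \<tau> * X e) \<partial>measure_pmf ?E)"
    proof (intro nn_integral_mono_AE AE_pmfI)
      fix e assume "e \<in> set_pmf ?E"
      then obtain e1 e2 where e: "e = (e1, e2)" "length e1 = \<tau>" "length e2 = \<tau>"
        using length_walkers by (metis surj_pair)
      have "real (epoch_count R \<tau> (Suc s) (h1 @ e1, h2 @ e2)) / \<tau>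
          = real (epoch_count R \<tau> s (h1, h2)) / \<tau> + X e / \<tau>"
        using length_walkers[OF h] e assms(2)
        by (simp add: epoch_count_append X add_divide_distrib)
      moreover have "exp (X e / \<tau>) \<le> 1 + 2 * (X e / \<tau>)"
        using X01[of e] assms(2) by (intro exp_le_one_plus_two) (auto simp: divide_le_eq)
      ultimately have "exp (real (epoch_count R \<tau> (Suc s) (h1 @ e1, h2 @ e2)) / \<tau>)
          \<le> exp (real (epoch_count R \<tau> s (h1, h2)) / \<tau>) * (1 + 2 / real \<tau> * X e)"
        by (simp add: exp_add mult_left_mono)
      moreover have "0 \<le> 1 + 2 / real \<tau> * X e" using X01[of e] by simp
      ultimately show "ennreal (exp (real (epoch_count R \<tau> (Suc s) (h1 @ fst e, h2 @ snd e)) / \<tau>))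
          \<le> ennreal (exp (real (epoch_count R \<tau> s (h1, h2)) / \<tau>)) * ennreal (1 + 2 / real \<tau> * X e)"
        unfolding e(1) fst_conv snd_conv
        by (subst ennreal_mult[symmetric]) (auto intro: ennreal_leI)
    qed
    also have "\<dots> = ennreal (exp (real (epoch_count R \<tau> s (h1, h2)) / \<tau>))
        * (\<integral>\<^sup>+ e. ennreal (1 + 2 / real \<tau> * X e) \<partial>measure_pmf ?E)"
      by (simp add: nn_integral_cmult)
    also have "(\<integral>\<^sup>+ e. ennreal (1 + 2 / real \<tau> * X e) \<partial>measure_pmf ?E) \<le> ennreal (exp (2 * p))"
    proof -
      have int: "integrable (measure_pmf ?E) X"
        unfolding X_def by (intro Bochner_Integration.integrable_sum) (simp add: measure_pmf.integrable_const_bound[where B = 1])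
      have "(\<integral>\<^sup>+ e. ennreal (1 + 2 / real \<tau> * X e) \<partial>measure_pmf ?E)
          = ennreal (\<integral> e. 1 + 2 / real \<tau> * X e \<partial>measure_pmf ?E)"
        using int X01 by (intro nn_integral_eq_integral) auto
      also have "(\<integral> e. 1 + 2 / real \<tau> * X e \<partial>measure_pmf ?E) = 1 + 2 / real \<tau> * (\<integral> e. X e \<partial>measure_pmf ?E)"
        using int by simp
      also have "\<dots> \<le> exp (2 * p)"
      proof -
        have "(\<integral> e. X e \<partial>measure_pmf ?E) = (\<Sum>j<\<tau>. measure_pmf.prob ?E {(e1, e2). R h1 h2 j e1 e2})"
          unfolding X_def
          by (subst Bochner_Integration.integral_sum) (auto simp: measure_pmf.integrable_const_bound[where B = 1])
        also have "\<dots> \<le> (\<Sum>j<\<tau>. p)" by (intro sum_mono p) simp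
        finally have "2 / real \<tau> * (\<integral> e. X e \<partial>measure_pmf ?E) \<le> 2 / real \<tau> * (\<Sum>j<\<tau>. p)"
          by (intro mult_left_mono) auto
        also have "\<dots> = 2 * p" using assms(2) by simp
        finally have "1 + 2 / real \<tau> * (\<integral> e. X e \<partial>measure_pmf ?E) \<le> 1 + 2 * p" by simp
        also have "\<dots> \<le> exp (2 * p)" by (rule exp_ge_add_one_self)
        finally show ?thesis .
      qed
      finally show ?thesis by (simp add: ennreal_leI)
    qed
    finally show ?thesis by (simp add: mult_left_mono)
  qed
  have "(\<integral>\<^sup>+ w. ennreal (exp (real (epoch_count R \<tau> (Suc s) w) / \<tau>)) \<partial>walkers G \<tau> (Suc s * \<tau>))
      = (\<integral>\<^sup>+ h. (\<integral>\<^sup>+ w. ennreal (exp (real (epoch_count R \<tau> (Suc s) w) / \<tau>))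
        \<partial>map_pmf (\<lambda>(e1, e2). (fst h @ e1, snd h @ e2)) ?E) \<partial>walkers G \<tau> (s * \<tau>))"
    unfolding walkers_append by (simp add: case_prod_unfold)
  also have "\<dots> \<le> (\<integral>\<^sup>+ h. ennreal (exp (real (epoch_count R \<tau> s h) / \<tau>)) * ennreal (exp (2 * p))
      \<partial>walkers G \<tau> (s * \<tau>))"
    using step by (intro nn_integral_mono_AE AE_pmfI) (metis prod.collapse)
  also have "\<dots> = (\<integral>\<^sup>+ h. ennreal (exp (real (epoch_count R \<tau> s h) / \<tau>)) \<partial>walkers G \<tau> (s * \<tau>))
      * ennreal (exp (2 * p))"
    by (simp add: nn_integral_multc)
  also have "\<dots> \<le> ennreal (exp (2 * real s * p)) * ennreal (exp (2 * p))"
    by (intro mult_right_mono Suc.IH) simp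
  also have "\<dots> = ennreal (exp (2 * real (Suc s) * p))"
    by (simp add: ennreal_mult[symmetric] exp_add[symmetric] algebra_simps)
  finally show ?case .
qed

text \<open>Markov's inequality for the exponential minus 1. Subtracting 1 lets the bound vanish
  with \<open>p\<close>, which \<open>epoch_count_tail_one\<close> exploits at the threshold
  1.\<close>

lemma epoch_count_tail:
  assumes p: "\<And>h1 h2 j. j < \<tau> \<Longrightarrow> measure_pmf.prob (walkers G \<tau> \<tau>) {(e1, e2). R h1 h2 j e1 e2} \<le> p"
    and "\<tau> > 0" "y > 0"
  shows "measure_pmf.prob (walkers G \<tau> (s * \<tau>)) {w. y \<le> real (epoch_count R \<tau> s w)}
    \<le> (exp (2 * real s * p) - 1) / (exp (y / \<tau>) - 1)"
proof -
  let ?M = "walkers G \<tau> (s * \<tau>)"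
  define f where "f w = exp (real (epoch_count R \<tau> s w) / \<tau>)" for w
  have moment: "(\<integral>\<^sup>+ w. ennreal (f w) \<partial>measure_pmf ?M) \<le> ennreal (exp (2 * real s * p))"
    unfolding f_def by (rule epoch_count_exp_moment[OF p assms(2)])
  have int: "integrable (measure_pmf ?M) f"
    using moment by (intro integrableI_nonneg) (auto simp: f_def top_unique less_top[symmetric])
  have "ennreal (\<integral> w. f w \<partial>measure_pmf ?M) \<le> ennreal (exp (2 * real s * p))"
  proof -
    have "(\<integral>\<^sup>+ w. ennreal (f w) \<partial>measure_pmf ?M) = ennreal (\<integral> w. f w \<partial>measure_pmf ?M)"
      using int by (rule nn_integral_eq_integral) (simp add: f_def)
    then show ?thesis using moment by metis
  qed
  then have le: "(\<integral> w. f w \<partial>measure_pmf ?M) \<le> exp (2 * real s * p)" by simp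
  have pos: "exp (y / \<tau>) - 1 > 0" using assms(2,3) by simp
  have int1: "integrable (measure_pmf ?M) (\<lambda>w. f w - 1)" using int by simp
  have f1: "AE w in measure_pmf ?M. 0 \<le> f w - 1" by (simp add: f_def)
  have "measure_pmf.prob ?M {w. y \<le> real (epoch_count R \<tau> s w)}
      = measure_pmf.prob ?M {w \<in> space (measure_pmf ?M). exp (y / \<tau>) - 1 \<le> f w - 1}"
    using assms(2) by (simp add: f_def divide_le_cancel)
  also have "\<dots> \<le> (\<integral> w. f w - 1 \<partial>measure_pmf ?M) / (exp (y / \<tau>) - 1)"
    by (rule integral_Markov_inequality_measure[OF int1 sets.empty_sets f1 pos])
  also have "(\<integral> w. f w - 1 \<partial>measure_pmf ?M) = (\<integral> w. f w \<partial>measure_pmf ?M) - 1"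
    using int by simp
  also have "((\<integral> w. f w \<partial>measure_pmf ?M) - 1) / (exp (y / \<tau>) - 1)
      \<le> (exp (2 * real s * p) - 1) / (exp (y / \<tau>) - 1)"
    using le less_imp_le[OF pos] by (intro divide_right_mono diff_right_mono)
  finally show ?thesis .
qed

text \<open>Fubini: the bound may be checked with the first coordinate frozen. The primed version
  freezes the second.\<close>

lemma prob_pair_pmf_le:
  assumes "\<And>x. x \<in> set_pmf M \<Longrightarrow> measure_pmf.prob N {y. Q x y} \<le> b" "b \<ge> 0"
  shows "measure_pmf.prob (pair_pmf M N) {(x, y). Q x y} \<le> b"
proof -
  have "emeasure (measure_pmf (pair_pmf M N)) {(x, y). Q x y}
      = (\<integral>\<^sup>+x. emeasure (measure_pmf N) {y. Q x y} \<partial>measure_pmf M)"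
    by (simp add: nn_integral_indicator[symmetric] nn_integral_pair_pmf' indicator_def
        flip: nn_integral_indicator)
  also have "\<dots> \<le> (\<integral>\<^sup>+x. ennreal b \<partial>measure_pmf M)"
    using assms by (intro nn_integral_mono_AE AE_pmfI) (simp add: measure_pmf.emeasure_eq_measure ennreal_leI)
  also have "\<dots> = ennreal b" by simp
  finally show ?thesis using assms(2) by (simp add: measure_pmf.emeasure_eq_measure)
qed

lemma prob_pair_pmf_le':
  assumes "\<And>y. y \<in> set_pmf N \<Longrightarrow> measure_pmf.prob M {x. Q x y} \<le> b" "b \<ge> 0"
  shows "measure_pmf.prob (pair_pmf M N) {(x, y). Q x y} \<le> b"
proof -
  have "measure_pmf.prob (pair_pmf M N) {(x, y). Q x y}
      = measure_pmf.prob (pair_pmf N M) {(y, x). Q x y}"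
    by (subst pair_commute_pmf) (simp add: vimage_def case_prod_unfold)
  then show ?thesis using prob_pair_pmf_le[OF assms] by simp
qed

lemma prob_pair_pmf_conj:
  "measure_pmf.prob (pair_pmf M N) {(x, y). P x \<and> Q y}
    = measure_pmf.prob M {x. P x} * measure_pmf.prob N {y. Q y}"
proof -
  have "emeasure (measure_pmf (pair_pmf M N)) {(x, y). P x \<and> Q y}
      = (\<integral>\<^sup>+x. (\<integral>\<^sup>+y. indicator {x. P x} x * indicator {y. Q y} y \<partial>measure_pmf N) \<partial>measure_pmf M)"
    by (simp add: nn_integral_pair_pmf' flip: nn_integral_indicator)
      (intro nn_integral_cong, simp add: indicator_def)
  also have "\<dots> = emeasure (measure_pmf M) {x. P x} * emeasure (measure_pmf N) {y. Q y}"
    by (simp add: nn_integral_cmult nn_integral_multc)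
  finally show ?thesis
    by (simp add: measure_pmf.emeasure_eq_measure ennreal_mult[symmetric])
qed

section \<open>Probabilities within one epoch\<close>

context regular_girth_graph
begin

text \<open>By \<open>card_extensions\<close> the number of choices at each step is the same for all
  walks so far, so \<open>pmf_of_set_Sigma\<close> propagates uniformity. Probabilities within an
  epoch thus become quotients of counts.\<close>

lemma walker_eq_pmf_of_set:
  assumes "L \<le> \<tau>" shows "walker G \<tau> L = pmf_of_set (nb_walks L)"
  using assms
proof (induction L)
  case 0
  have "nb_walks 0 = {[]}" by (auto simp: nb_walks_def nb_walk_def)
  then show ?case by (simp add: pmf_of_set_singleton)
next
  case (Suc L)
  define c where "c = (if L = 0 then order else if L = 1 then k else k - 1)"
  have c: "c > 0" using order_pos degree_ge_3 by (simp add: c_def)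
  have card: "card (extensions h) = c" if "h \<in> nb_walks L" for h
    using that card_extensions[of h] by (auto simp: nb_walks_def c_def)
  have next_eq: "next_position G \<tau> h = pmf_of_set (extensions h)" if "h \<in> nb_walks L" for h
  proof -
    have "length h = L" "length h mod \<tau> = L" using that Suc.prems by (auto simp: nb_walks_def)
    moreover have "last h = h ! (L - 1)" if "h \<noteq> []"
      using that \<open>length h = L\<close> by (simp add: last_conv_nth)
    ultimately show ?thesis
      by (auto simp: next_position_def extensions_def Let_def)
  qed
  have "walker G \<tau> (Suc L)
      = bind_pmf (pmf_of_set (nb_walks L)) (\<lambda>h. map_pmf (\<lambda>v. h @ [v]) (next_position G \<tau> h))"
    using Suc by simp
  also have "\<dots> = bind_pmf (pmf_of_set (nb_walks L))
      (\<lambda>h. map_pmf (\<lambda>(h, v). h @ [v]) (map_pmf (Pair h) (pmf_of_set (extensions h))))"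
    by (intro bind_pmf_cong refl) (simp add: next_eq nb_walks_nonempty pmf.map_comp comp_def)
  also have "\<dots> = map_pmf (\<lambda>(h, v). h @ [v]) (pmf_of_set (Sigma (nb_walks L) extensions))"
    by (subst pmf_of_set_Sigma[symmetric, OF nb_walks_finite nb_walks_nonempty finite_extensions card c])
      (simp_all add: map_bind_pmf)
  also have "\<dots> = pmf_of_set (nb_walks (Suc L))"
  proof -
    have "Sigma (nb_walks L) extensions \<noteq> {}"
      using nb_walks_nonempty[of "Suc L"] unfolding nb_walks_Suc by blast
    then show ?thesis
      unfolding nb_walks_Suc
      by (intro map_pmf_of_set_inj inj_on_snoc) (auto simp: finite_extensions)
  qed
  finally show ?case .
qed

lemma set_walker: "L \<le> \<tau> \<Longrightarrow> set_pmf (walker G \<tau> L) = nb_walks L"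
  by (simp add: walker_eq_pmf_of_set nb_walks_nonempty)

text \<open>An event about the first \<open>Suc j\<close> positions can be counted on walks with
  \<open>Suc j\<close> vertices, where the last vertex is the position at offset
  \<open>j\<close>.\<close>

lemma prob_walker_prefix:
  assumes "j < \<tau>" "\<And>e. length e = \<tau> \<Longrightarrow> P (take (Suc j) e) \<longleftrightarrow> Q e"
  shows "measure_pmf.prob (walker G \<tau> \<tau>) {e. Q e}
    = real (card {h \<in> nb_walks (Suc j). P h}) / real (card (nb_walks (Suc j)))"
proof -
  have "measure_pmf.prob (walker G \<tau> \<tau>) {e. Q e} = measure_pmf.prob (walker G \<tau> \<tau>) {e. P (take (Suc j) e)}"
    using assms(2) by (intro measure_prob_cong_0) (auto simp: pmf_eq_0_set_pmf dest: length_walker)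
  also have "\<dots> = measure_pmf.prob (map_pmf (take (Suc j)) (walker G \<tau> \<tau>)) {h. P h}"
    by (simp add: vimage_def)
  also have "map_pmf (take (Suc j)) (walker G \<tau> \<tau>) = pmf_of_set (nb_walks (Suc j))"
    using assms(1) map_take_walker[of "Suc j" \<tau> G \<tau>] walker_eq_pmf_of_set[of "Suc j" \<tau>] by simp
  also have "measure_pmf.prob \<dots> {h. P h} = real (card (nb_walks (Suc j) \<inter> {h. P h})) / real (card (nb_walks (Suc j)))"
    by (intro measure_pmf_of_set nb_walks_nonempty nb_walks_finite)
  finally show ?thesis by (simp add: Int_def)
qed

lemma prob_walker_at:
  assumes "j < \<tau>"
  shows "measure_pmf.prob (walker G \<tau> \<tau>) {e. e ! j = y} \<le> 1 / order"
proof -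
  have "measure_pmf.prob (walker G \<tau> \<tau>) {e. e ! j = y}
      = real (card {h \<in> nb_walks (Suc j). h ! j = y}) / real (card (nb_walks (Suc j)))"
    using assms by (intro prob_walker_prefix) auto
  also have "\<dots> \<le> real (count_from j) / real (card (nb_walks (Suc j)))"
    by (intro divide_right_mono) (simp_all add: card_nb_walks_end)
  also have "\<dots> = 1 / order" using count_from_pos[of j] by (simp add: card_nb_walks)
  finally show ?thesis .
qed

lemma prob_walker_in:
  assumes "j < \<tau>" "finite H"
  shows "measure_pmf.prob (walker G \<tau> \<tau>) {e. e ! j \<in> H} \<le> card H / order"
proof -
  have "measure_pmf.prob (walker G \<tau> \<tau>) {e. e ! j \<in> H}
      = measure_pmf.prob (walker G \<tau> \<tau>) (\<Union>y\<in>H. {e. e ! j = y})"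
    by (rule arg_cong[where f = "measure_pmf.prob _"]) auto
  also have "\<dots> \<le> (\<Sum>y\<in>H. measure_pmf.prob (walker G \<tau> \<tau>) {e. e ! j = y})"
    using assms(2) by (intro measure_pmf.finite_measure_subadditive_finite) auto
  also have "\<dots> \<le> (\<Sum>y\<in>H. 1 / order)" by (intro sum_mono prob_walker_at assms)
  finally show ?thesis by simp
qed

lemma prob_walker_return:
  assumes "i < j" "j < \<tau>"
  shows "measure_pmf.prob (walker G \<tau> \<tau>) {e. e ! i = e ! j} \<le> 1 / real (k - 1) ^ g"
proof -
  have pos: "real (k - 1) ^ g > 0" using degree_ge_3 by simp
  have "measure_pmf.prob (walker G \<tau> \<tau>) {e. e ! i = e ! j}
      = real (card {h \<in> nb_walks (Suc j). h ! i = h ! j}) / real (card (nb_walks (Suc j)))"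
    using assms by (intro prob_walker_prefix) auto
  also have "\<dots> \<le> 1 / real (k - 1) ^ g"
  proof -
    have "real (card (nb_walks (Suc j))) > 0"
      using nb_walks_nonempty[of "Suc j"] by (simp add: card_gt_0_iff)
    moreover have "real (card {h \<in> nb_walks (Suc j). h ! i = h ! j}) * real (k - 1) ^ g
        \<le> real (card (nb_walks (Suc j)))"
      using card_nb_walks_return[OF assms(1)] by (metis of_nat_le_iff of_nat_mult of_nat_power)
    ultimately show ?thesis using pos by (simp add: divide_simps)
  qed
  finally show ?thesis .
qed

text \<open>Visits by either walker count, since both can raise a load. Only \<open>r < j\<close>
  matters, because the loads compared at offset \<open>j\<close> are those before that ball; a
  meeting at offset \<open>j\<close> itself is no collision.\<close>

definition epoch_collision :: "nat \<Rightarrow> 'a list \<Rightarrow> 'a list \<Rightarrow> bool" where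
  "epoch_collision j e1 e2 \<longleftrightarrow> (\<exists>r<j. e1 ! j \<in> {e1 ! r, e2 ! r} \<or> e2 ! j \<in> {e1 ! r, e2 ! r})"

text \<open>Union bound over \<open>r < j\<close> and four coincidences. Each of the two
  self-returns has probability at most \<open>1 / real (k - 1) ^ g\<close>. Each coincidence between
  different walkers has probability at most \<open>1 / order\<close>: with the walk at offset
  \<open>r\<close> frozen, the other one is uniform at offset \<open>j\<close>.\<close>

lemma prob_epoch_collision:
  assumes "j < \<tau>"
  shows "measure_pmf.prob (walkers G \<tau> \<tau>) {(e1, e2). epoch_collision j e1 e2}
    \<le> 2 * real \<tau> * (1 / real (k - 1) ^ g + 1 / order)"
proof -
  let ?E = "walkers G \<tau> \<tau>" and ?b = "1 / real (k - 1) ^ g"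
  have b: "0 \<le> ?b" by simp
  have one: "measure_pmf.prob ?E {(e1, e2). e1 ! j \<in> {e1 ! r, e2 ! r} \<or> e2 ! j \<in> {e1 ! r, e2 ! r}}
      \<le> 2 * (?b + 1 / order)" if r: "r < j" for r
  proof -
    have eq: "{(e1, e2). e1 ! j \<in> {e1 ! r, e2 ! r} \<or> e2 ! j \<in> {e1 ! r, e2 ! r}}
        = ({(e1, e2). e1 ! r = e1 ! j} \<union> {(e1, e2). e1 ! j = e2 ! r})
          \<union> ({(e1, e2). e2 ! j = e1 ! r} \<union> {(e1, e2). e2 ! r = e2 ! j})"
      by auto
    have "measure_pmf.prob ?E {(e1, e2). e1 ! r = e1 ! j} \<le> ?b"
      unfolding walkers_def using prob_walker_return[OF r assms] b
      by (intro prob_pair_pmf_le'[where Q = "\<lambda>e1 e2. e1 ! r = e1 ! j"]) auto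
    moreover have "measure_pmf.prob ?E {(e1, e2). e2 ! r = e2 ! j} \<le> ?b"
      unfolding walkers_def using prob_walker_return[OF r assms] b
      by (intro prob_pair_pmf_le[where Q = "\<lambda>e1 e2. e2 ! r = e2 ! j"]) auto
    moreover have "measure_pmf.prob ?E {(e1, e2). e1 ! j = e2 ! r} \<le> 1 / order"
      unfolding walkers_def using prob_walker_at[OF assms]
      by (intro prob_pair_pmf_le'[where Q = "\<lambda>e1 e2. e1 ! j = e2 ! r"]) auto
    moreover have "measure_pmf.prob ?E {(e1, e2). e2 ! j = e1 ! r} \<le> 1 / order"
      unfolding walkers_def using prob_walker_at[OF assms]
      by (intro prob_pair_pmf_le[where Q = "\<lambda>e1 e2. e2 ! j = e1 ! r"]) auto
    moreover have "measure_pmf.prob ?E (A \<union> B) \<le> measure_pmf.prob ?E A + measure_pmf.prob ?E B" for A B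
      by (intro measure_Un_le) auto
    ultimately show ?thesis unfolding eq by (smt (verit))
  qed
  have "measure_pmf.prob ?E {(e1, e2). epoch_collision j e1 e2}
      = measure_pmf.prob ?E (\<Union>r\<in>{..<j}. {(e1, e2). e1 ! j \<in> {e1 ! r, e2 ! r} \<or> e2 ! j \<in> {e1 ! r, e2 ! r}})"
    by (rule arg_cong[where f = "measure_pmf.prob _"]) (auto simp: epoch_collision_def)
  also have "\<dots> \<le> (\<Sum>r<j. measure_pmf.prob ?E {(e1, e2). e1 ! j \<in> {e1 ! r, e2 ! r} \<or> e2 ! j \<in> {e1 ! r, e2 ! r}})"
    by (intro measure_pmf.finite_measure_subadditive_finite) auto
  also have "\<dots> \<le> (\<Sum>r<j. 2 * (?b + 1 / order))" by (intro sum_mono one) simp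
  also have "\<dots> = real j * (2 * (?b + 1 / order))" by simp
  also have "\<dots> \<le> real \<tau> * (2 * (?b + 1 / order))" using assms by (intro mult_right_mono) auto
  finally show ?thesis by (simp only: ac_simps)
qed

lemma prob_both_in:
  assumes "j < \<tau>" "finite H" "real (card H) \<le> B"
  shows "measure_pmf.prob (walkers G \<tau> \<tau>) {(e1, e2). e1 ! j \<in> H \<and> e2 ! j \<in> H} \<le> (B / order)\<^sup>2"
proof -
  let ?q = "measure_pmf.prob (walker G \<tau> \<tau>) {e. e ! j \<in> H}"
  have "?q \<le> B / order"
    using prob_walker_in[OF assms(1,2)] assms(3) by (meson divide_right_mono of_nat_0_le_iff order_trans)
  then have "?q * ?q \<le> (B / order)\<^sup>2"
    unfolding power2_eq_square by (intro mult_mono) (auto intro: order_trans[OF measure_nonneg])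
  then show ?thesis unfolding walkers_def
    by (subst prob_pair_pmf_conj[where P = "\<lambda>e. e ! j \<in> H" and Q = "\<lambda>e. e ! j \<in> H"])
qed

text \<open>Two visits to the same vertex are at least \<open>2 g + 1\<close> steps apart.\<close>

lemma card_visits:
  assumes "nb_walk e" "g > 0"
  shows "card {r. r < length e \<and> e ! r = v} \<le> length e div g + 1"
proof -
  \<comment> \<open>Each block of \<open>g\<close> consecutive times contains at most one visit, so
    visits are counted by blocks.\<close>
  have "inj_on (\<lambda>r. r div g) {r. r < length e \<and> e ! r = v}"
  proof (rule linorder_inj_onI)
    fix a b assume ab: "a < b" "a \<in> {r. r < length e \<and> e ! r = v}" "b \<in> {r. r < length e \<and> e ! r = v}"
    then have "2 * g + 1 \<le> b - a" by (intro closed_nb_walk_length[OF assms(1)]) auto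
    then have "a + g \<le> b" by simp
    then have "(a + g) div g \<le> b div g" by (rule div_le_mono)
    then show "a div g \<noteq> b div g" using assms(2) by simp
  qed auto
  moreover have "(\<lambda>r. r div g) ` {r. r < length e \<and> e ! r = v} \<subseteq> {..length e div g}"
    by (auto intro: div_le_mono)
  ultimately have "card {r. r < length e \<and> e ! r = v} \<le> card {..length e div g}"
    by (rule card_inj_on_le) simp
  then show ?thesis by simp
qed

end

section \<open>Loads and the charging of bins to times\<close>

definition chosen :: "'a tie_rule \<Rightarrow> 'a list \<Rightarrow> 'a list \<Rightarrow> nat \<Rightarrow> 'a" where
  "chosen tie w1 w2 t = chosen_bin tie w1 w2 t (load tie w1 w2 t)"

text \<open>The tie rule, too, sees only the histories up to the present, so the loads at time
  \<open>t\<close> are determined by the first \<open>t\<close> positions.\<close>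

lemma load_take:
  "t \<le> m \<Longrightarrow> load tie (take m w1) (take m w2) t = load tie w1 w2 t"
  by (induction t) (auto simp: chosen_bin_def Let_def min_def)

lemma load_eq_card: "load tie w1 w2 t v = card {r. r < t \<and> chosen tie w1 w2 r = v}"
proof (induction t)
  case (Suc t)
  have "{r. r < Suc t \<and> chosen tie w1 w2 r = v}
      = (if chosen tie w1 w2 t = v then insert t {r. r < t \<and> chosen tie w1 w2 r = v}
         else {r. r < t \<and> chosen tie w1 w2 r = v})"
    by (auto simp: less_Suc_eq)
  then show ?case using Suc by (auto simp: Let_def chosen_def)
qed simp

lemma load_mono: "s \<le> t \<Longrightarrow> load tie w1 w2 s v \<le> load tie w1 w2 t v"
  unfolding load_eq_card by (intro card_mono) auto

lemma chosen_cases: "chosen tie w1 w2 t = w1 ! t \<or> chosen tie w1 w2 t = w2 ! t"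
  by (auto simp: chosen_def chosen_bin_def)

lemma load_chosen_le:
  "load tie w1 w2 t (chosen tie w1 w2 t) \<le> load tie w1 w2 t (w1 ! t)"
  "load tie w1 w2 t (chosen tie w1 w2 t) \<le> load tie w1 w2 t (w2 ! t)"
  by (auto simp: chosen_def chosen_bin_def)

text \<open>A ball enters \<open>v\<close> only while a walker is there.\<close>

lemma load_le_visits:
  assumes "s \<le> t"
  shows "load tie w1 w2 t v \<le> load tie w1 w2 s v
    + card {r. s \<le> r \<and> r < t \<and> w1 ! r = v} + card {r. s \<le> r \<and> r < t \<and> w2 ! r = v}"
proof -
  have "load tie w1 w2 t v \<le> card ({r. r < s \<and> chosen tie w1 w2 r = v}
      \<union> {r. s \<le> r \<and> r < t \<and> w1 ! r = v} \<union> {r. s \<le> r \<and> r < t \<and> w2 ! r = v})"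
    unfolding load_eq_card[of tie w1 w2 t]
  proof (intro card_mono subsetI)
    fix r assume "r \<in> {r. r < t \<and> chosen tie w1 w2 r = v}"
    then show "r \<in> {r. r < s \<and> chosen tie w1 w2 r = v}
      \<union> {r. s \<le> r \<and> r < t \<and> w1 ! r = v} \<union> {r. s \<le> r \<and> r < t \<and> w2 ! r = v}"
      using chosen_cases[of tie w1 w2 r] by auto
  qed auto
  also have "\<dots> \<le> card {r. r < s \<and> chosen tie w1 w2 r = v}
      + card {r. s \<le> r \<and> r < t \<and> w1 ! r = v} + card {r. s \<le> r \<and> r < t \<and> w2 ! r = v}"
    by (meson add_right_mono card_Un_le order_trans)
  finally show ?thesis by (simp only: load_eq_card)
qed

text \<open>Loads rise by single balls, so the ball that lifts \<open>v\<close> past level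
  \<open>i\<close> finds it at load exactly \<open>i\<close>.\<close>

lemma load_reaches:
  assumes "Suc i \<le> load tie w1 w2 T v"
  obtains t where "t < T" "chosen tie w1 w2 t = v" "load tie w1 w2 t v = i"
proof -
  have "\<exists>t<T. chosen tie w1 w2 t = v \<and> load tie w1 w2 t v = i"
    using assms
  proof (induction T)
    case (Suc T)
    show ?case
    proof (cases "Suc i \<le> load tie w1 w2 T v")
      case True
      then show ?thesis using Suc.IH by (meson less_Suc_eq)
    next
      case False
      then have "chosen tie w1 w2 T = v \<and> load tie w1 w2 T v = i"
        using Suc.prems by (auto simp: Let_def chosen_def split: if_splits)
      then show ?thesis by blast
    qed
  qed simp
  then show ?thesis using that by blast
qed

text \<open>Only \<open>T\<close> balls are available; this starts the recursion over the
  levels.\<close>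

lemma card_loaded_mult_le:
  assumes "finite V"
  shows "card {v \<in> V. i \<le> load tie w1 w2 T v} * i \<le> T"
proof -
  let ?H = "{v \<in> V. i \<le> load tie w1 w2 T v}"
  have "card ?H * i \<le> (\<Sum>v\<in>?H. load tie w1 w2 T v)"
    using sum_mono[of ?H "\<lambda>_. i" "load tie w1 w2 T"] by simp
  also have "\<dots> = card (\<Union>v\<in>?H. {r. r < T \<and> chosen tie w1 w2 r = v})"
    unfolding load_eq_card using assms by (intro card_UN_disjoint[symmetric]) auto
  also have "\<dots> \<le> card {..<T}" by (intro card_mono) auto
  finally show ?thesis by simp
qed

text \<open>Charge each bin to the ball that lifted it from \<open>i\<close> to
  \<open>Suc i\<close>. The chosen bin was the less loaded one, so both candidates had load at least
  \<open>i\<close>; distinct bins are charged to distinct times.\<close>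

lemma card_loaded_Suc_le:
  "card {v \<in> V. Suc i \<le> load tie w1 w2 T v}
    \<le> card {t. t < T \<and> i \<le> load tie w1 w2 t (w1 ! t) \<and> i \<le> load tie w1 w2 t (w2 ! t)}"
proof -
  let ?A = "{t. t < T \<and> i \<le> load tie w1 w2 t (w1 ! t) \<and> i \<le> load tie w1 w2 t (w2 ! t)}"
  have "{v \<in> V. Suc i \<le> load tie w1 w2 T v} \<subseteq> chosen tie w1 w2 ` ?A"
  proof
    fix v assume "v \<in> {v \<in> V. Suc i \<le> load tie w1 w2 T v}"
    then obtain t where t: "t < T" "chosen tie w1 w2 t = v" "load tie w1 w2 t v = i"
      using load_reaches[of i tie w1 w2 T v] by blast
    then have "t \<in> ?A" using load_chosen_le[of tie w1 w2 t] by simp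
    then show "v \<in> chosen tie w1 w2 ` ?A" using t(2) by blast
  qed
  then show ?thesis by (rule surj_card_le[rotated]) simp
qed

section \<open>Recursion for the heavy bins along fixed trajectories\<close>

context regular_girth_graph
begin

definition heavy :: "'a tie_rule \<Rightarrow> nat \<Rightarrow> 'a list \<Rightarrow> 'a list \<Rightarrow> nat \<Rightarrow> 'a set" where
  "heavy tie i w1 w2 t = {v \<in> pverts G. i \<le> load tie w1 w2 t v}"

lemma finite_heavy [simp]: "finite (heavy tie i w1 w2 t)"
  using pair_finite_verts by (simp add: heavy_def)

text \<open>\<open>length h1\<close> is the starting time of the epoch. The clause on
  \<open>card H\<close> is built in so that the probability bound holds for every history, as the
  exponential moment requires: with too many heavy bins the event is empty.\<close>

definition both_heavy ::
  "'a tie_rule \<Rightarrow> nat \<Rightarrow> real \<Rightarrow> 'a list \<Rightarrow> 'a list \<Rightarrow> nat \<Rightarrow> 'a list \<Rightarrow> 'a list \<Rightarrow> bool" where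
  "both_heavy tie i B h1 h2 j e1 e2 \<longleftrightarrow> (let H = heavy tie i h1 h2 (length h1) in
     real (card H) \<le> B \<and> e1 ! j \<in> H \<and> e2 ! j \<in> H)"

lemma prob_both_heavy:
  assumes "j < \<tau>"
  shows "measure_pmf.prob (walkers G \<tau> \<tau>) {(e1, e2). both_heavy tie i B h1 h2 j e1 e2} \<le> (B / order)\<^sup>2"
proof (cases "real (card (heavy tie i h1 h2 (length h1))) \<le> B")
  case True
  then have "{(e1, e2). both_heavy tie i B h1 h2 j e1 e2} = {(e1, e2).
      e1 ! j \<in> heavy tie i h1 h2 (length h1) \<and> e2 ! j \<in> heavy tie i h1 h2 (length h1)}"
    by (simp add: both_heavy_def Let_def)
  then show ?thesis using prob_both_in[OF assms finite_heavy True] by metis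
next
  case False
  then show ?thesis by (simp add: both_heavy_def case_prod_unfold)
qed

lemma walker_epoch:
  assumes "w \<in> set_pmf (walker G \<tau> (s * \<tau>))" "u < s"
  shows "take \<tau> (drop (u * \<tau>) w) \<in> nb_walks \<tau>"
  using assms
proof (induction s arbitrary: w)
  case (Suc s)
  have "w \<in> set_pmf (walker G \<tau> (s * \<tau> + \<tau>))" using Suc.prems(1) by (simp add: add.commute)
  then obtain h e where w: "w = h @ e" and h: "h \<in> set_pmf (walker G \<tau> (s * \<tau>))"
    and e: "e \<in> set_pmf (walker G \<tau> \<tau>)"
    unfolding walker_append[OF order_refl] by auto
  have len: "length h = s * \<tau>" "length e = \<tau>" using h e by (simp_all add: length_walker)
  show ?case
  proof (cases "u = s")
    case True
    then show ?thesis using w len e by (simp add: set_walker)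
  next
    case False
    then have "u < s" using Suc.prems(2) by simp
    then have "Suc u * \<tau> \<le> s * \<tau>" by (intro mult_le_mono1) simp
    then have le: "u * \<tau> + \<tau> \<le> s * \<tau>" by (simp add: add.commute)
    have "u * \<tau> - s * \<tau> = 0" using \<open>u < s\<close> by simp
    then show ?thesis using Suc.IH[OF h \<open>u < s\<close>] w len le by simp
  qed
qed simp

context
  fixes w1 w2 :: "'a list" and \<tau> s :: nat and tie :: "'a tie_rule"
  assumes \<tau>: "\<tau> > 0"
    and w1: "w1 \<in> set_pmf (walker G \<tau> (s * \<tau>))" and w2: "w2 \<in> set_pmf (walker G \<tau> (s * \<tau>))"
begin

lemma epoch_start: 
  assumes "t < s * \<tau>"
  shows "t div \<tau> < s" "t div \<tau> * \<tau> \<le> t" "t div \<tau> * \<tau> + \<tau> \<le> s * \<tau>"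
    "t < t div \<tau> * \<tau> + \<tau>" "t div \<tau> * \<tau> \<le> s * \<tau>"
proof -
  show *: "t div \<tau> < s" using assms \<tau> by (simp add: less_mult_imp_div_less)
  have "Suc (t div \<tau>) * \<tau> \<le> s * \<tau>" using * by (intro mult_le_mono1) simp
  then show "t div \<tau> * \<tau> + \<tau> \<le> s * \<tau>" by (simp add: add.commute)
  then show "t div \<tau> * \<tau> \<le> s * \<tau>" by linarith
  show "t div \<tau> * \<tau> \<le> t" by simp
  show "t < t div \<tau> * \<tau> + \<tau>" using \<tau> by (metis add.commute dividend_less_div_times)
qed

lemma epoch_nth:
  assumes "length w = s * \<tau>" "t < s * \<tau>"
  shows "t div \<tau> * \<tau> \<le> r \<Longrightarrow> r \<le> t \<Longrightarrow> take \<tau> (drop (t div \<tau> * \<tau>) w) ! (r - t div \<tau> * \<tau>) = w ! r"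
    and "take \<tau> (drop (t div \<tau> * \<tau>) w) ! (t mod \<tau>) = w ! t"
proof -
  have le: "t div \<tau> * \<tau> \<le> length w" using epoch_start(5)[OF assms(2)] assms(1) by simp
  have *: "take \<tau> (drop (t div \<tau> * \<tau>) w) ! (r - t div \<tau> * \<tau>) = w ! r"
    if r: "t div \<tau> * \<tau> \<le> r" "r \<le> t" for r
  proof -
    have "r - t div \<tau> * \<tau> < \<tau>" using r(2) epoch_start(4)[OF assms(2)] \<tau> by linarith
    then show ?thesis using le r(1) by (simp only: nth_take nth_drop le_add_diff_inverse)
  qed
  then show "t div \<tau> * \<tau> \<le> r \<Longrightarrow> r \<le> t \<Longrightarrow> take \<tau> (drop (t div \<tau> * \<tau>) w) ! (r - t div \<tau> * \<tau>) = w ! r" .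
  show "take \<tau> (drop (t div \<tau> * \<tau>) w) ! (t mod \<tau>) = w ! t"
    using *[OF epoch_start(2)[OF assms(2)] order_refl] by (simp add: minus_div_mult_eq_mod)
qed

lemma position_in_verts:
  assumes "w \<in> set_pmf (walker G \<tau> (s * \<tau>))" "t < s * \<tau>"
  shows "w ! t \<in> pverts G"
proof -
  let ?e = "take \<tau> (drop (t div \<tau> * \<tau>) w)"
  have e: "length ?e = \<tau>" "set ?e \<subseteq> pverts G"
    using walker_epoch[OF assms(1) epoch_start(1)[OF assms(2)]]
    by (auto simp: nb_walks_def nb_walk_def)
  have "t mod \<tau> < length ?e" unfolding e(1) using \<tau> by simp
  then have "?e ! (t mod \<tau>) \<in> pverts G" using e(2) nth_mem by blast
  then show ?thesis using epoch_nth(2)[OF length_walker[OF assms(1)] assms(2)] by simp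
qed

lemma at_epoch_both_heavy:
  assumes "t < s * \<tau>"
  shows "at_epoch (both_heavy tie i B) \<tau> t (w1, w2) \<longleftrightarrow>
    (let H = heavy tie i w1 w2 (t div \<tau> * \<tau>) in real (card H) \<le> B \<and> w1 ! t \<in> H \<and> w2 ! t \<in> H)"
proof -
  let ?\<sigma> = "t div \<tau> * \<tau>"
  have "length w1 = s * \<tau>" "length w2 = s * \<tau>" using w1 w2 by (simp_all add: length_walker)
  moreover from this have "load tie (take ?\<sigma> w1) (take ?\<sigma> w2) ?\<sigma> = load tie w1 w2 ?\<sigma>"
    by (intro load_take) simp
  ultimately show ?thesis
    using epoch_start[OF assms] \<tau> by (simp add: at_epoch_def both_heavy_def heavy_def Let_def)
qed

lemma at_epoch_collision:
  assumes "t < s * \<tau>" "t div \<tau> * \<tau> \<le> r" "r < t" "w1 ! t \<in> {w1 ! r, w2 ! r} \<or> w2 ! t \<in> {w1 ! r, w2 ! r}"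
  shows "at_epoch (\<lambda>_ _. epoch_collision) \<tau> t (w1, w2)"
proof -
  let ?\<sigma> = "t div \<tau> * \<tau>"
  have len: "length w1 = s * \<tau>" "length w2 = s * \<tau>" using w1 w2 by (simp_all add: length_walker)
  have r: "r - ?\<sigma> < t mod \<tau>" using assms(2,3) by (simp add: minus_div_mult_eq_mod[symmetric] diff_less_mono)
  have m: "t mod \<tau> < \<tau>" using \<tau> by simp
  have n: "take \<tau> (drop ?\<sigma> w) ! (r - ?\<sigma>) = w ! r" "take \<tau> (drop ?\<sigma> w) ! (t mod \<tau>) = w ! t"
    if "length w = s * \<tau>" for w :: "'a list"
    using epoch_nth[OF that assms(1)] assms(2,3) by simp_all
  show ?thesis
    unfolding at_epoch_def Let_def epoch_collision_def fst_conv snd_conv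
    using r assms(4) n len by (intro exI[of _ "r - ?\<sigma>"]) simp
qed

text \<open>Without a collision neither walker visited \<open>v\<close> earlier in the epoch, so its
  load has not changed since the epoch began.\<close>

lemma load_at_epoch_start:
  assumes t: "t < s * \<tau>" and i: "i \<le> load tie w1 w2 t v" "v = w1 ! t \<or> v = w2 ! t"
    and no: "\<not> at_epoch (\<lambda>_ _. epoch_collision) \<tau> t (w1, w2)"
  shows "i \<le> load tie w1 w2 (t div \<tau> * \<tau>) v"
proof -
  let ?\<sigma> = "t div \<tau> * \<tau>"
  have "w1 ! r \<noteq> v \<and> w2 ! r \<noteq> v" if "?\<sigma> \<le> r" "r < t" for r
    using at_epoch_collision[OF t that] i(2) no by auto
  then have none: "{r. ?\<sigma> \<le> r \<and> r < t \<and> w1 ! r = v} = {}" "{r. ?\<sigma> \<le> r \<and> r < t \<and> w2 ! r = v} = {}"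
    by auto
  show ?thesis
    using load_le_visits[OF epoch_start(2)[OF t], of tie w1 w2 v] i(1)
    unfolding none card.empty by linarith
qed

text \<open>Loads never decrease, so a bound at the end of the run is valid at the start of every
  epoch.\<close>

lemma card_heavy_mono:
  assumes "real (card (heavy tie i w1 w2 (s * \<tau>))) \<le> B" "t \<le> s * \<tau>"
  shows "real (card (heavy tie i w1 w2 t)) \<le> B"
proof -
  have "heavy tie i w1 w2 t \<subseteq> heavy tie i w1 w2 (s * \<tau>)"
    using load_mono[OF assms(2), of tie w1 w2] by (auto simp: heavy_def intro: order_trans)
  then have "card (heavy tie i w1 w2 t) \<le> card (heavy tie i w1 w2 (s * \<tau>))"
    by (intro card_mono) simp
  then show ?thesis using assms(1) by linarith
qed

text \<open>By \<open>card_loaded_Suc_le\<close> it suffices to count the times with both candidates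
  at level \<open>i\<close>. At each of them there is a collision, or both bins were heavy already
  when the epoch began.\<close>

lemma card_heavy_Suc:
  assumes "real (card (heavy tie i w1 w2 (s * \<tau>))) \<le> B"
  shows "card (heavy tie (Suc i) w1 w2 (s * \<tau>))
    \<le> epoch_count (both_heavy tie i B) \<tau> s (w1, w2)
      + epoch_count (\<lambda>_ _. epoch_collision) \<tau> s (w1, w2)"
proof -
  let ?A = "{t. t < s * \<tau> \<and> i \<le> load tie w1 w2 t (w1 ! t) \<and> i \<le> load tie w1 w2 t (w2 ! t)}"
  have "?A \<subseteq> {t. t < s * \<tau> \<and> at_epoch (both_heavy tie i B) \<tau> t (w1, w2)}
      \<union> {t. t < s * \<tau> \<and> at_epoch (\<lambda>_ _. epoch_collision) \<tau> t (w1, w2)}" (is "_ \<subseteq> ?U")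
  proof
    fix t assume t: "t \<in> ?A"
    show "t \<in> ?U"
    proof (cases "at_epoch (\<lambda>_ _. epoch_collision) \<tau> t (w1, w2)")
      case False
      then have "i \<le> load tie w1 w2 (t div \<tau> * \<tau>) (w1 ! t)" "i \<le> load tie w1 w2 (t div \<tau> * \<tau>) (w2 ! t)"
        using t load_at_epoch_start by blast+
      moreover have "w1 ! t \<in> pverts G" "w2 ! t \<in> pverts G"
        using t w1 w2 position_in_verts by auto
      moreover have "real (card (heavy tie i w1 w2 (t div \<tau> * \<tau>))) \<le> B"
        using t by (intro card_heavy_mono[OF assms] epoch_start(5)) auto
      ultimately have "at_epoch (both_heavy tie i B) \<tau> t (w1, w2)"
        using t by (simp add: at_epoch_both_heavy Let_def heavy_def)
      then show ?thesis using t by blast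
    qed (use t in auto)
  qed
  then have "card ?A \<le> card ?U" by (intro card_mono) auto
  also have "\<dots> \<le> epoch_count (both_heavy tie i B) \<tau> s (w1, w2)
      + epoch_count (\<lambda>_ _. epoch_collision) \<tau> s (w1, w2)"
    unfolding epoch_count_def by (rule card_Un_le)
  finally show ?thesis
    using card_loaded_Suc_le[of "pverts G" i tie w1 w2 "s * \<tau>"] unfolding heavy_def by linarith
qed

lemma card_epoch_visits:
  assumes "g > 0" "w \<in> set_pmf (walker G \<tau> (s * \<tau>))" "t < s * \<tau>"
  shows "card {r. t div \<tau> * \<tau> \<le> r \<and> r < t \<and> w ! r = v} \<le> \<tau> div g + 1"
proof -
  let ?\<sigma> = "t div \<tau> * \<tau>" and ?e = "take \<tau> (drop (t div \<tau> * \<tau>) w)"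
  have e: "nb_walk ?e" "length ?e = \<tau>"
    using walker_epoch[OF assms(2) epoch_start(1)[OF assms(3)]] by (auto simp: nb_walks_def)
  have "(\<lambda>r. r - ?\<sigma>) ` {r. ?\<sigma> \<le> r \<and> r < t \<and> w ! r = v} \<subseteq> {r. r < length ?e \<and> ?e ! r = v}"
    using epoch_start[OF assms(3)] length_walker[OF assms(2)] unfolding e(2) by auto
  then have "card {r. ?\<sigma> \<le> r \<and> r < t \<and> w ! r = v} \<le> card {r. r < length ?e \<and> ?e ! r = v}"
    by (intro card_inj_on_le[where f = "\<lambda>r. r - ?\<sigma>"]) (auto simp: inj_on_def)
  also have "\<dots> \<le> length ?e div g + 1" by (rule card_visits[OF e(1) assms(1)])
  finally show ?thesis unfolding e(2) .
qed

text \<open>Each of the two walkers visits a bin at most \<open>\<tau> div g + 1\<close> times in an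
  epoch, so load \<open>i + 2 * (\<tau> div g + 1)\<close> at any time in it forces load
  \<open>i\<close> at its start. The collision term disappears, at the price of more levels per
  squaring.\<close>

lemma card_heavy_jump:
  assumes "real (card (heavy tie i w1 w2 (s * \<tau>))) \<le> B" "g > 0"
  shows "card (heavy tie (Suc (i + 2 * (\<tau> div g + 1))) w1 w2 (s * \<tau>))
    \<le> epoch_count (both_heavy tie i B) \<tau> s (w1, w2)"
proof -
  let ?i = "i + 2 * (\<tau> div g + 1)"
  let ?A = "{t. t < s * \<tau> \<and> ?i \<le> load tie w1 w2 t (w1 ! t) \<and> ?i \<le> load tie w1 w2 t (w2 ! t)}"
  have "?A \<subseteq> {t. t < s * \<tau> \<and> at_epoch (both_heavy tie i B) \<tau> t (w1, w2)}"
  proof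
    fix t assume t: "t \<in> ?A"
    have "i \<le> load tie w1 w2 (t div \<tau> * \<tau>) v" if "?i \<le> load tie w1 w2 t v" for v
      using load_le_visits[OF epoch_start(2)[of t], of tie w1 w2 v] that t
        card_epoch_visits[OF assms(2) w1, of t v] card_epoch_visits[OF assms(2) w2, of t v] by simp
    moreover have "w1 ! t \<in> pverts G" "w2 ! t \<in> pverts G"
      using t w1 w2 position_in_verts by auto
    moreover have "real (card (heavy tie i w1 w2 (t div \<tau> * \<tau>))) \<le> B"
      using t by (intro card_heavy_mono[OF assms(1)] epoch_start(5)) auto
    ultimately show "t \<in> {t. t < s * \<tau> \<and> at_epoch (both_heavy tie i B) \<tau> t (w1, w2)}"
      using t by (simp add: at_epoch_both_heavy Let_def heavy_def)
  qed
  then have "card ?A \<le> epoch_count (both_heavy tie i B) \<tau> s (w1, w2)"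
    unfolding epoch_count_def by (intro card_mono) auto
  then show ?thesis
    using card_loaded_Suc_le[of "pverts G" ?i tie w1 w2 "s * \<tau>"] unfolding heavy_def by linarith
qed

end

end

section \<open>Tail bounds for the number of heavy bins\<close>

lemma exp_ratio_le:
  fixes a b :: real
  assumes "a \<le> b" "b > 0"
  shows "(exp a - 1) / (exp b - 1) \<le> exp (a - b)"
proof -
  have "exp a - 1 \<le> exp (a - b) * (exp b - 1)"
    using assms by (simp add: right_diff_distrib flip: exp_add)
  then show ?thesis using assms by (simp add: divide_le_eq)
qed

lemma prob_mono_on_support:
  assumes "\<And>x. x \<in> set_pmf M \<Longrightarrow> x \<in> A \<Longrightarrow> x \<in> B"
  shows "measure_pmf.prob M A \<le> measure_pmf.prob M B"
  using assms by (intro measure_pmf.finite_measure_mono_AE AE_pmfI) auto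

text \<open>\<open>m\<close> stands for the number of vertices; whole epochs are run, up to
  \<open>2 * m\<close> steps. The condition \<open>8 * m * p \<le> y\<close> makes
  \<open>2 * s * p\<close> at most half of the exponent \<open>y / \<tau>\<close>, and the other
  half remains.\<close>

lemma epoch_count_tail_exp:
  assumes p: "\<And>h1 h2 j. j < \<tau> \<Longrightarrow> measure_pmf.prob (walkers G \<tau> \<tau>) {(e1, e2). R h1 h2 j e1 e2} \<le> p"
    and "\<tau> > 0" "y > 0" "p \<ge> 0" and s: "real (s * \<tau>) \<le> 2 * m" and y: "8 * m * p \<le> y"
  shows "measure_pmf.prob (walkers G \<tau> (s * \<tau>)) {w. y \<le> real (epoch_count R \<tau> s w)}
    \<le> exp (- y / (2 * real \<tau>))"
proof -
  have \<tau>: "real \<tau> > 0" using assms(2) by simp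
  have "real s * real \<tau> * p \<le> 2 * m * p" using s assms(4) by (intro mult_right_mono) auto
  then have "2 * real s * p * (2 * real \<tau>) \<le> y" using y by (simp add: algebra_simps)
  then have a: "2 * real s * p \<le> y / (2 * real \<tau>)" using \<tau> by (simp add: pos_le_divide_eq)
  have half: "y / \<tau> = y / (2 * real \<tau>) + y / (2 * real \<tau>)" by simp
  have pos: "y / (2 * real \<tau>) > 0" using \<tau> assms(3) by simp
  have "measure_pmf.prob (walkers G \<tau> (s * \<tau>)) {w. y \<le> real (epoch_count R \<tau> s w)}
      \<le> (exp (2 * real s * p) - 1) / (exp (y / \<tau>) - 1)"
    by (rule epoch_count_tail[OF p assms(2,3)])
  also have "\<dots> \<le> exp (2 * real s * p - y / \<tau>)"
    using a pos half by (intro exp_ratio_le) linarith+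
  also have "\<dots> \<le> exp (- y / (2 * real \<tau>))" using a half by simp
  finally show ?thesis .
qed

text \<open>A bound linear in \<open>p\<close>: in \<open>epoch_count_tail\<close> the numerator is
  at most \<open>4 * s * p\<close> because \<open>2 * s * p \<le> 1\<close>, and the denominator is
  at least \<open>1 / \<tau>\<close>.\<close>

lemma epoch_count_tail_one:
  assumes p: "\<And>h1 h2 j. j < \<tau> \<Longrightarrow> measure_pmf.prob (walkers G \<tau> \<tau>) {(e1, e2). R h1 h2 j e1 e2} \<le> p"
    and "\<tau> > 0" "p \<ge> 0" and s: "real (s * \<tau>) \<le> 2 * m" and small: "4 * m * p \<le> \<tau>"
  shows "measure_pmf.prob (walkers G \<tau> (s * \<tau>)) {w. 1 \<le> real (epoch_count R \<tau> s w)} \<le> 8 * m * p"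
proof -
  have \<tau>: "real \<tau> > 0" using assms(2) by simp
  have "real s * real \<tau> * p \<le> 2 * m * p" using s assms(3) by (intro mult_right_mono) auto
  then have mp: "2 * real s * p * real \<tau> \<le> 4 * m * p" by (simp add: algebra_simps)
  then have "2 * real s * p * real \<tau> \<le> 1 * real \<tau>" using small by linarith
  then have a: "2 * real s * p \<le> 1" using \<tau> by (rule mult_right_le_imp_le)
  have "measure_pmf.prob (walkers G \<tau> (s * \<tau>)) {w. 1 \<le> real (epoch_count R \<tau> s w)}
      \<le> (exp (2 * real s * p) - 1) / (exp (1 / \<tau>) - 1)"
    by (rule epoch_count_tail[OF p assms(2) zero_less_one])
  also have "\<dots> \<le> (2 * (2 * real s * p)) / (1 / \<tau>)"
  proof (rule frac_le)
    show "exp (2 * real s * p) - 1 \<le> 2 * (2 * real s * p)"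
      using exp_le_one_plus_two[of "2 * real s * p"] a assms(3) by simp
    show "1 / real \<tau> \<le> exp (1 / real \<tau>) - 1" using exp_ge_add_one_self[of "1 / real \<tau>"] by linarith
  qed (use \<tau> assms(3) in auto)
  also have "\<dots> = 2 * (2 * real s * p * real \<tau>)" by simp
  also have "\<dots> \<le> 8 * m * p" using mp by linarith
  finally show ?thesis .
qed

context regular_girth_graph
begin

text \<open>\<open>B = 0\<close> asks whether any bin reaches level \<open>i\<close>. The time is
  the end of an epoch because the counts run over whole epochs.\<close>

definition overload :: "'a tie_rule \<Rightarrow> nat \<Rightarrow> nat \<Rightarrow> nat \<Rightarrow> real \<Rightarrow> real" where
  "overload tie \<tau> s i B = measure_pmf.prob (walkers G \<tau> (s * \<tau>))
     {(w1, w2). B < real (card (heavy tie i w1 w2 (s * \<tau>)))}"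

lemma overload_antimono:
  assumes "B \<le> B'" "i \<le> i'" shows "overload tie \<tau> s i' B' \<le> overload tie \<tau> s i B"
  unfolding overload_def
proof (intro prob_mono_on_support, clarify)
  fix w1 w2 assume *: "B' < real (card (heavy tie i' w1 w2 (s * \<tau>)))"
  have "card (heavy tie i' w1 w2 (s * \<tau>)) \<le> card (heavy tie i w1 w2 (s * \<tau>))"
    using assms(2) by (intro card_mono) (auto simp: heavy_def)
  then show "B < real (card (heavy tie i w1 w2 (s * \<tau>)))" using * assms(1) by linarith
qed

lemma overload_initial:
  assumes "real (s * \<tau>) \<le> real i * B" "i > 0"
  shows "overload tie \<tau> s i B = 0"
proof -
  have "\<not> B < real (card (heavy tie i w1 w2 (s * \<tau>)))" for w1 w2
  proof
    assume "B < real (card (heavy tie i w1 w2 (s * \<tau>)))"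
    then have "real i * B < real i * real (card (heavy tie i w1 w2 (s * \<tau>)))"
      using assms(2) by (intro mult_strict_left_mono) auto
    moreover have "real (card (heavy tie i w1 w2 (s * \<tau>)) * i) \<le> real (s * \<tau>)"
      using card_loaded_mult_le[OF pair_finite_verts, of i tie w1 w2 "s * \<tau>"]
      unfolding heavy_def of_nat_le_iff .
    ultimately show False using assms(1) by (simp add: mult.commute)
  qed
  then show ?thesis by (simp add: overload_def)
qed

text \<open>\<open>y\<close> is the budget for times with both bins heavy at the start of their
  epoch, \<open>K\<close> the budget for collisions. Each is at least four times the bound
  \<open>2 * order * p\<close> on the mean of its count, so \<open>epoch_count_tail_exp\<close>
  applies to both.\<close>

lemma overload_Suc:
  assumes "\<tau> > 0" and s: "real (s * \<tau>) \<le> 2 * real order"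
    and y: "y > 0" "8 * B\<^sup>2 / order \<le> y"
    and K: "K > 0" "8 * real order * (2 * real \<tau> * (1 / real (k - 1) ^ g + 1 / order)) \<le> K"
  shows "overload tie \<tau> s (Suc i) (y + K)
    \<le> overload tie \<tau> s i B + exp (- y / (2 * real \<tau>)) + exp (- K / (2 * real \<tau>))"
proof -
  let ?M = "walkers G \<tau> (s * \<tau>)"
  let ?A = "{(w1, w2). B < real (card (heavy tie i w1 w2 (s * \<tau>)))}"
    and ?Y = "{w. y \<le> real (epoch_count (both_heavy tie i B) \<tau> s w)}"
    and ?K = "{w. K \<le> real (epoch_count (\<lambda>_ _. epoch_collision) \<tau> s w)}"
  have "overload tie \<tau> s (Suc i) (y + K) \<le> measure_pmf.prob ?M (?A \<union> ?Y \<union> ?K)"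
    unfolding overload_def
  proof (intro prob_mono_on_support, clarify)
    fix w1 w2
    assume w: "(w1, w2) \<in> set_pmf ?M" and gt: "y + K < real (card (heavy tie (Suc i) w1 w2 (s * \<tau>)))"
      and no: "\<not> K \<le> real (epoch_count (\<lambda>_ _. epoch_collision) \<tau> s (w1, w2))"
        "\<not> y \<le> real (epoch_count (both_heavy tie i B) \<tau> s (w1, w2))"
    have w12: "w1 \<in> set_pmf (walker G \<tau> (s * \<tau>))" "w2 \<in> set_pmf (walker G \<tau> (s * \<tau>))"
      using w by (auto simp: walkers_def)
    show "B < real (card (heavy tie i w1 w2 (s * \<tau>)))"
    proof (rule ccontr)
      assume "\<not> B < real (card (heavy tie i w1 w2 (s * \<tau>)))"
      then have "card (heavy tie (Suc i) w1 w2 (s * \<tau>))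
          \<le> epoch_count (both_heavy tie i B) \<tau> s (w1, w2)
            + epoch_count (\<lambda>_ _. epoch_collision) \<tau> s (w1, w2)"
        by (intro card_heavy_Suc assms(1) w12) simp
      then show False using gt no by linarith
    qed
  qed
  also have "\<dots> \<le> measure_pmf.prob ?M ?A + measure_pmf.prob ?M ?Y + measure_pmf.prob ?M ?K"
    by (rule order_trans[OF measure_Un_le add_right_mono[OF measure_Un_le]]) auto
  also have "measure_pmf.prob ?M ?Y \<le> exp (- y / (2 * real \<tau>))"
  proof (rule epoch_count_tail_exp[OF prob_both_heavy assms(1) y(1) _ s])
    show "8 * real order * (B / real order)\<^sup>2 \<le> y"
      using y by (simp add: power2_eq_square)
  qed auto
  also have "measure_pmf.prob ?M ?K \<le> exp (- K / (2 * real \<tau>))"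
    by (rule epoch_count_tail_exp[OF prob_epoch_collision assms(1) K(1) _ s K(2)]) auto
  finally show ?thesis by (simp add: overload_def)
qed

text \<open>Two thresholds serve two uses: \<open>y' = y\<close> for the exponential tail, and
  \<open>y = 0\<close> with \<open>y' = 1\<close>, since counts are integers. \<open>J\<close> only
  has to exceed the levels of one jump, so it can stay fixed while \<open>\<tau>\<close> and
  \<open>g\<close> vary.\<close>

lemma overload_jump_event:
  assumes "\<tau> > 0" "g > 0" and J: "2 * (\<tau> div g + 1) < J"
    and Y: "\<And>m. y < real m \<Longrightarrow> y' \<le> real m"
  shows "overload tie \<tau> s (i + J) y \<le> overload tie \<tau> s i B
    + measure_pmf.prob (walkers G \<tau> (s * \<tau>)) {w. y' \<le> real (epoch_count (both_heavy tie i B) \<tau> s w)}"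
proof -
  let ?M = "walkers G \<tau> (s * \<tau>)" and ?J = "Suc (i + 2 * (\<tau> div g + 1))"
  let ?A = "{(w1, w2). B < real (card (heavy tie i w1 w2 (s * \<tau>)))}"
    and ?Y = "{w. y' \<le> real (epoch_count (both_heavy tie i B) \<tau> s w)}"
  have "overload tie \<tau> s (i + J) y \<le> overload tie \<tau> s ?J y"
    using J by (intro overload_antimono) auto
  also have "\<dots> \<le> measure_pmf.prob ?M (?A \<union> ?Y)"
    unfolding overload_def
  proof (intro prob_mono_on_support, clarify)
    fix w1 w2
    assume w: "(w1, w2) \<in> set_pmf ?M" and gt: "y < real (card (heavy tie ?J w1 w2 (s * \<tau>)))"
      and no: "\<not> y' \<le> real (epoch_count (both_heavy tie i B) \<tau> s (w1, w2))"
    have w12: "w1 \<in> set_pmf (walker G \<tau> (s * \<tau>))" "w2 \<in> set_pmf (walker G \<tau> (s * \<tau>))"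
      using w by (auto simp: walkers_def)
    show "B < real (card (heavy tie i w1 w2 (s * \<tau>)))"
    proof (rule ccontr)
      assume "\<not> B < real (card (heavy tie i w1 w2 (s * \<tau>)))"
      then have "card (heavy tie ?J w1 w2 (s * \<tau>)) \<le> epoch_count (both_heavy tie i B) \<tau> s (w1, w2)"
        by (intro card_heavy_jump assms(1,2) w12) simp
      then have "y < real (epoch_count (both_heavy tie i B) \<tau> s (w1, w2))" using gt by linarith
      then show False using Y no by blast
    qed
  qed
  also have "\<dots> \<le> measure_pmf.prob ?M ?A + measure_pmf.prob ?M ?Y"
    by (intro measure_Un_le) auto
  finally show ?thesis by (simp add: overload_def)
qed

lemma overload_jump:
  assumes "\<tau> > 0" "g > 0" "2 * (\<tau> div g + 1) < J" and s: "real (s * \<tau>) \<le> 2 * real order"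
    and y: "y > 0" "8 * B\<^sup>2 / order \<le> y"
  shows "overload tie \<tau> s (i + J) y \<le> overload tie \<tau> s i B + exp (- y / (2 * real \<tau>))"
proof -
  have "measure_pmf.prob (walkers G \<tau> (s * \<tau>)) {w. y \<le> real (epoch_count (both_heavy tie i B) \<tau> s w)}
      \<le> exp (- y / (2 * real \<tau>))"
  proof (rule epoch_count_tail_exp[OF prob_both_heavy assms(1) y(1) _ s])
    show "8 * real order * (B / real order)\<^sup>2 \<le> y"
      using y by (simp add: power2_eq_square)
  qed auto
  then show ?thesis using overload_jump_event[OF assms(1-3), of y y tie s i B] by linarith
qed

text \<open>The jump to no bins at all: the linear bound \<open>epoch_count_tail_one\<close> on the
  probability of any hit takes the place of the exponential tail.\<close>

lemma overload_last:
  assumes "\<tau> > 0" "g > 0" "2 * (\<tau> div g + 1) < J" and s: "real (s * \<tau>) \<le> 2 * real order"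
    and B: "4 * B\<^sup>2 / order \<le> \<tau>"
  shows "overload tie \<tau> s (i + J) 0 \<le> overload tie \<tau> s i B + 8 * B\<^sup>2 / order"
proof -
  have eq: "real order * (B / real order)\<^sup>2 = B\<^sup>2 / order"
    using order_pos by (simp add: power2_eq_square)
  have "measure_pmf.prob (walkers G \<tau> (s * \<tau>)) {w. 1 \<le> real (epoch_count (both_heavy tie i B) \<tau> s w)}
      \<le> 8 * real order * (B / real order)\<^sup>2"
    using B eq by (intro epoch_count_tail_one[OF prob_both_heavy assms(1) _ s]) auto
  then show ?thesis using overload_jump_event[OF assms(1-3), of 0 1 tie s i B] eq by simp
qed

text \<open>The run is prolonged to the end of an epoch. Its first \<open>n\<close> positions have
  the required law, and loads only grow.\<close>

lemma prob_max_load_le: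
  assumes "\<tau> > 0" "n \<le> s * \<tau>" "real i \<le> b"
  shows "1 - overload tie \<tau> s i 0
    \<le> measure_pmf.prob (walkers G \<tau> n) {(w1, w2). real (max_load G tie w1 w2 n) \<le> b}"
proof -
  let ?M = "walkers G \<tau> (s * \<tau>)"
  let ?A = "{(w1, w2). 0 < real (card (heavy tie i w1 w2 (s * \<tau>)))}"
  have "1 - overload tie \<tau> s i 0 = measure_pmf.prob ?M (- ?A)"
    by (simp add: overload_def measure_pmf.prob_compl[symmetric] Compl_eq_Diff_UNIV)
  also have "\<dots> \<le> measure_pmf.prob ?M (map_prod (take n) (take n) -` {(w1, w2). real (max_load G tie w1 w2 n) \<le> b})"
  proof (rule prob_mono_on_support)
    fix w assume "w \<in> - ?A"
    then obtain w1 w2 where w: "w = (w1, w2)" and none: "heavy tie i w1 w2 (s * \<tau>) = {}"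
      by (cases w) auto
    have "load tie w1 w2 n v < i" if "v \<in> pverts G" for v
    proof (rule ccontr)
      assume "\<not> load tie w1 w2 n v < i"
      then have "v \<in> heavy tie i w1 w2 (s * \<tau>)"
        using that load_mono[OF assms(2), of tie w1 w2 v] by (simp add: heavy_def)
      then show False using none by simp
    qed
    then have "Max (load tie w1 w2 n ` pverts G) < i"
      using pair_finite_verts verts_nonempty by (subst Max_less_iff) auto
    then show "w \<in> map_prod (take n) (take n) -` {(w1, w2). real (max_load G tie w1 w2 n) \<le> b}"
      using assms(3) by (simp add: w max_load_def load_take)
  qed
  also have "\<dots> = measure_pmf.prob (walkers G \<tau> n) {(w1, w2). real (max_load G tie w1 w2 n) \<le> b}"
    by (simp only: map_take_walkers[OF assms(2), of G \<tau>, symmetric] measure_map_pmf)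
  finally show ?thesis .
qed

end

section \<open>Iteration of the tail bounds over the levels\<close>

text \<open>Here \<open>f n i B\<close> is the probability that more than \<open>B\<close> bins reach load \<open>i\<close>. The recursion
  \<open>B \<mapsto> 8 B\<^sup>2 / n\<close> is run level by level down to \<open>n\<close> to a power smaller than 1; from there
  boundedly many squarings, each at a cost of \<open>J\<close> levels, suffice.\<close>

locale layered_tail =
  fixes f :: "nat \<Rightarrow> nat \<Rightarrow> real \<Rightarrow> real" and \<tau> :: "nat \<Rightarrow> real" and F :: "nat filter"
    and c d :: real and J :: nat
  assumes F: "F \<le> sequentially" and d: "0 < d" "d \<le> 1 / 3" and c: "c > 0"
    and nonneg: "\<And>n i B. 0 \<le> f n i B"
    and antimono: "\<And>n i B B'. B \<le> B' \<Longrightarrow> f n i B' \<le> f n i B"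
    and \<tau>: "\<forall>\<^sub>F n in F. 1 \<le> \<tau> n \<and> \<tau> n \<le> c * ln n"
    and initial: "\<forall>\<^sub>F n in F. f n 64 (n / 32) = 0"
    and one_level: "\<forall>\<^sub>F n in F. \<forall>i B y. 0 < y \<longrightarrow> 8 * B\<^sup>2 / n \<le> y \<longrightarrow>
      f n (Suc i) (y + n powr (1 - d))
        \<le> f n i B + exp (- y / (2 * \<tau> n)) + exp (- (n powr (1 - d)) / (2 * \<tau> n))"
    and jump: "\<forall>\<^sub>F n in F. \<forall>i B y. 0 < y \<longrightarrow> 8 * B\<^sup>2 / n \<le> y \<longrightarrow>
      f n (i + J) y \<le> f n i B + exp (- y / (2 * \<tau> n))"
    and last: "\<forall>\<^sub>F n in F. \<forall>i B. 4 * B\<^sup>2 / n \<le> \<tau> n \<longrightarrow>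
      f n (i + J) 0 \<le> f n i B + 8 * B\<^sup>2 / n"
begin

definition levels :: "nat \<Rightarrow> nat" where "levels n = nat \<lceil>log 2 (ln n)\<rceil>"

text \<open>A larger \<open>e\<close> means fewer bins. \<open>C\<close> may depend on
  \<open>e\<close> but not on \<open>n\<close>, so only boundedly many improvements can be
  chained.\<close>

definition good :: "real \<Rightarrow> bool" where
  "good e \<longleftrightarrow> (\<exists>C. ((\<lambda>n. f n (levels n + C) (n powr (1 - e))) \<longlongrightarrow> 0) F)"

lemma eventually_F: "eventually P sequentially \<Longrightarrow> eventually P F"
  using F by (simp add: le_filter_def)

lemma tendsto_F: "(X \<longlongrightarrow> l) sequentially \<Longrightarrow> (X \<longlongrightarrow> l) F"
  using F by (rule tendsto_mono)

text \<open>Bins are counted in units of \<open>n / 16\<close>. Then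
  \<open>8 * B\<^sup>2 / n\<close> becomes half the square of the fraction and the collision budget
  \<open>n powr (1 - d)\<close> becomes \<open>16 * n powr - d\<close>, which the floor
  \<open>64 * n powr - d\<close> absorbs. The \<open>1 / 2\<close> at \<open>i = 0\<close> matches
  the start: \<open>2 * n\<close> balls fill at most \<open>n / 32\<close> bins to load 64.\<close>

definition fraction :: "nat \<Rightarrow> nat \<Rightarrow> real" where
  "fraction n i = max ((1 / 2) ^ 2 ^ i) (64 * n powr - d)"

text \<open>With \<open>a\<close> and \<open>D\<close> the arguments of the maximum, the halved
  square is at most \<open>a\<^sup>2 / 2\<close> or \<open>D / 2\<close>, and the added term is
  \<open>D / 4\<close>.\<close>

lemma fraction_Suc:
  assumes "64 * n powr - d \<le> 1"
  shows "(fraction n i)\<^sup>2 / 2 + 16 * n powr - d \<le> fraction n (Suc i)"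
proof -
  define D where "D = 64 * n powr - d"
  define a where "a = (1 / 2 :: real) ^ 2 ^ i"
  have "a\<^sup>2 = (1 / 2) ^ 2 ^ Suc i" by (simp add: a_def power_mult[symmetric] mult.commute)
  then have fr: "fraction n i = max a D" "fraction n (Suc i) = max (a\<^sup>2) D"
    by (simp_all add: fraction_def a_def D_def)
  have D: "0 \<le> D" "D \<le> 1" using assms by (simp_all add: D_def)
  then have "D\<^sup>2 \<le> D" by (simp add: power2_eq_square mult_left_le)
  moreover have "16 * n powr - d = D / 4" by (simp add: D_def)
  ultimately show ?thesis
    unfolding fr using D by (cases "a \<le> D") (auto simp: max_def)
qed

text \<open>Each level costs two exponentials. The floor of \<open>fraction\<close> keeps
  \<open>y\<close> at least \<open>128 * n powr (1 - 2 * d)\<close>, so with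
  \<open>d \<le> 1 / 3\<close> both budgets are at least \<open>n powr (1 / 3)\<close>.\<close>

lemma first_phase_bound:
  assumes "64 * n powr - d \<le> 1" "n \<ge> 1" "1 \<le> \<tau> n" "\<tau> n \<le> c * ln n" and "f n 64 (n / 32) = 0"
    and step: "\<forall>i B y. 0 < y \<longrightarrow> 8 * B\<^sup>2 / n \<le> y \<longrightarrow>
      f n (Suc i) (y + n powr (1 - d))
        \<le> f n i B + exp (- y / (2 * \<tau> n)) + exp (- (n powr (1 - d)) / (2 * \<tau> n))"
  shows "f n (64 + i) (n * (fraction n i / 16)) \<le> real i * (2 * exp (- (n powr (1 / 3)) / (2 * c * ln n)))"
proof (induction i)
  case 0
  have "1 / 2 \<le> fraction n 0" by (simp add: fraction_def)
  then have "real n / 32 \<le> n * (fraction n 0 / 16)"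
    using mult_left_mono[of "1 / 32" "fraction n 0 / 16" "real n"] by simp
  then have "f n 64 (n * (fraction n 0 / 16)) \<le> 0" using antimono assms(5) by metis
  then show ?case by simp
next
  case (Suc i)
  let ?\<epsilon> = "exp (- (n powr (1 / 3)) / (2 * c * ln n))"
  define B where "B = n * (fraction n i / 16)"
  define y where "y = 8 * B\<^sup>2 / n"
  have n: "real n \<ge> 1" using assms(2) by simp
  have small: "exp (- z / (2 * \<tau> n)) \<le> ?\<epsilon>" if "n powr (1 / 3) \<le> z" for z
  proof -
    have "n powr (1 / 3) / (2 * c * ln n) \<le> z / (2 * \<tau> n)"
      using that assms(3,4) by (intro frac_le) (auto intro: order_trans[OF powr_ge_zero])
    then show ?thesis by simp
  qed
  have y_eq: "y = n * ((fraction n i)\<^sup>2 / 32)"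
    using n by (simp add: y_def B_def power2_eq_square)
  have pd: "n powr - d > 0" using n by simp
  have third: "n powr (1 / 3) \<le> n powr (1 - 2 * d)" "n powr (1 / 3) \<le> n powr (1 - d)"
    using n d by (intro powr_mono; simp)+
  have "64 * n powr - d \<le> fraction n i" by (simp add: fraction_def)
  then have "(64 * n powr - d)\<^sup>2 \<le> (fraction n i)\<^sup>2" using pd by (intro power_mono) auto
  then have "n * ((64 * n powr - d)\<^sup>2 / 32) \<le> y" unfolding y_eq using n by (intro mult_left_mono) auto
  moreover have "n * ((64 * n powr - d)\<^sup>2 / 32) = 128 * n powr (1 - 2 * d)"
  proof -
    have "(n powr - d)\<^sup>2 = n powr (- 2 * d)" using n by (simp add: power2_eq_square flip: powr_add)
    moreover have "n * n powr (- 2 * d) = n powr (1 - 2 * d)" using n by (simp add: powr_mult_base)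
    ultimately show ?thesis by (simp add: power_mult_distrib)
  qed
  moreover have "n powr (1 - 2 * d) > 0" using n by simp
  ultimately have y: "n powr (1 / 3) \<le> y" "0 < y" using third(1) by linarith+
  have "n * n powr - d = n powr (1 - d)" using n by (simp add: powr_mult_base)
  then have "y + n powr (1 - d) = n * (((fraction n i)\<^sup>2 / 2 + 16 * n powr - d) / 16)"
    by (simp add: y_eq algebra_simps)
  also have "\<dots> \<le> n * (fraction n (Suc i) / 16)"
    using fraction_Suc[OF assms(1), of i] n by (intro mult_left_mono divide_right_mono) auto
  finally have "f n (Suc (64 + i)) (n * (fraction n (Suc i) / 16)) \<le> f n (Suc (64 + i)) (y + n powr (1 - d))"
    by (rule antimono)
  also have "\<dots> \<le> f n (64 + i) B + exp (- y / (2 * \<tau> n)) + exp (- (n powr (1 - d)) / (2 * \<tau> n))"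
    using y(2) by (intro step[rule_format]) (simp_all add: y_def)
  also have "\<dots> \<le> real i * (2 * ?\<epsilon>) + ?\<epsilon> + ?\<epsilon>"
    using Suc small[OF y(1)] small[OF third(2)] unfolding B_def by linarith
  finally show ?case by (simp add: algebra_simps)
qed

text \<open>After \<open>levels n\<close> levels the doubly exponential term is at most
  \<open>2 powr - ln n = n powr - ln 2\<close>, below the floor because
  \<open>d \<le> 1 / 3 < ln 2\<close>. The bound is then \<open>4 * n powr (1 - d)\<close>; halving
  \<open>d\<close> absorbs the factor 4.\<close>

lemma good_initial: "good (d / 2)"
proof -
  let ?b = "\<lambda>n::nat. (log 2 (ln n) + 1) * (2 * exp (- (n powr (1 / 3)) / (2 * c * ln n)))"
  have "(?b \<longlongrightarrow> 0) sequentially" using c by real_asymp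
  then have lim: "(?b \<longlongrightarrow> 0) F" by (rule tendsto_F)
  have a1: "\<forall>\<^sub>F n::nat in sequentially. 64 * n powr - d \<le> 1" using d(1) by real_asymp
  have a2: "\<forall>\<^sub>F n::nat in sequentially. 4 * n powr (1 - d) \<le> n powr (1 - d / 2)"
    using d(1) by real_asymp
  have a3: "\<forall>\<^sub>F n::nat in sequentially. 1 \<le> ln n" by real_asymp
  have "\<forall>\<^sub>F n in F. f n (levels n + 64) (n powr (1 - d / 2)) \<le> ?b n"
    using eventually_F[OF a1] eventually_F[OF a2] eventually_F[OF a3] \<tau> initial one_level
      eventually_F[OF eventually_ge_at_top[of 1]]
  proof eventually_elim
    case (elim n)
    have l: "0 \<le> log 2 (ln n)" using elim(3) by simp
    have L: "log 2 (ln n) \<le> levels n" "real (levels n) \<le> log 2 (ln n) + 1"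
      unfolding levels_def using l by linarith+
    have "ln n = 2 powr log 2 (ln n)" using elim(3) by simp
    also have "\<dots> \<le> 2 powr real (levels n)" using L(1) by simp
    finally have ge: "ln n \<le> 2 ^ levels n" by (simp add: powr_realpow)
    have "(1 / 2 :: real) ^ 2 ^ levels n = 2 powr - (2 ^ levels n)"
      by (simp add: powr_minus powr_realpow[symmetric] power_one_over inverse_eq_divide)
    also have "\<dots> \<le> 2 powr - ln n" using ge by simp
    also have "\<dots> = n powr - ln 2" using elim(7) by (simp add: powr_def)
    also have "\<dots> \<le> n powr - d"
      using d(2) ln2_ge_two_thirds elim(7) by (intro powr_mono) auto
    also have "\<dots> \<le> 64 * n powr - d" by simp
    finally have "fraction n (levels n) = 64 * n powr - d" by (simp add: fraction_def max_def)
    then have "n * (fraction n (levels n) / 16) = 4 * n powr (1 - d)"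
      using elim(7) by (simp add: powr_diff powr_minus divide_simps)
    then have "n * (fraction n (levels n) / 16) \<le> n powr (1 - d / 2)" using elim(2) by simp
    then have "f n (levels n + 64) (n powr (1 - d / 2)) \<le> f n (64 + levels n) (n * (fraction n (levels n) / 16))"
      unfolding add.commute[of _ 64] by (rule antimono)
    also have "\<dots> \<le> real (levels n) * (2 * exp (- (n powr (1 / 3)) / (2 * c * ln n)))"
      using elim by (intro first_phase_bound) auto
    also have "\<dots> \<le> ?b n" using L(2) by (intro mult_right_mono) auto
    finally show ?case .
  qed
  then have "((\<lambda>n. f n (levels n + 64) (n powr (1 - d / 2))) \<longlongrightarrow> 0) F"
    by (rule tendsto_sandwich[OF _ _ tendsto_const lim, rotated]) (simp add: nonneg)
  then show ?thesis unfolding good_def by blast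
qed

text \<open>The recursion turns \<open>n powr (1 - e)\<close> into
  \<open>8 * n powr (1 - 2 * e)\<close>; giving up \<open>e / 2\<close> in the exponent absorbs the
  factor 8. The cap \<open>5 / 8\<close> keeps the target at least \<open>n powr (3 / 8)\<close>, so
  that the exponential error vanishes.\<close>

lemma good_step:
  assumes "good e" "0 < e" "e' \<le> 3 * e / 2" "e' \<le> 5 / 8"
  shows "good e'"
proof -
  obtain C where C: "((\<lambda>n. f n (levels n + C) (n powr (1 - e))) \<longlongrightarrow> 0) F"
    using assms(1) by (auto simp: good_def)
  let ?b = "\<lambda>n. f n (levels n + C) (n powr (1 - e)) + exp (- (n powr (3 / 8)) / (2 * c * ln n))"
  have "((\<lambda>n::nat. exp (- (n powr (3 / 8)) / (2 * c * ln n))) \<longlongrightarrow> 0) sequentially"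
    using c by real_asymp
  then have lim: "(?b \<longlongrightarrow> 0) F" using tendsto_add[OF C tendsto_F] by simp
  have a1: "\<forall>\<^sub>F n::nat in sequentially. 8 * n powr (1 - 2 * e) \<le> n powr (1 - 3 * e / 2)"
    using assms(2) by real_asymp
  have "\<forall>\<^sub>F n in F. f n (levels n + (C + J)) (n powr (1 - e')) \<le> ?b n"
    using eventually_F[OF a1] \<tau> jump eventually_F[OF eventually_ge_at_top[of 1]]
  proof eventually_elim
    case (elim n)
    have n: "real n \<ge> 1" using elim(4) by simp
    have "8 * (n powr (1 - e))\<^sup>2 / n = 8 * n powr (1 - 2 * e)"
    proof -
      have "(n powr (1 - e))\<^sup>2 = n powr (1 + (1 - 2 * e))"
        by (simp add: power2_eq_square flip: powr_add)
      also have "\<dots> = n * n powr (1 - 2 * e)" using n by (simp only: powr_add) simp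
      finally show ?thesis using n by simp
    qed
    also have "\<dots> \<le> n powr (1 - 3 * e / 2)" by (rule elim(1))
    also have "\<dots> \<le> n powr (1 - e')" using assms(3) n by (intro powr_mono) auto
    finally have "f n (levels n + C + J) (n powr (1 - e'))
        \<le> f n (levels n + C) (n powr (1 - e)) + exp (- (n powr (1 - e')) / (2 * \<tau> n))"
      using elim(3) n by simp
    also have "exp (- (n powr (1 - e')) / (2 * \<tau> n)) \<le> exp (- (n powr (3 / 8)) / (2 * c * ln n))"
    proof -
      have "n powr (3 / 8) \<le> n powr (1 - e')" using assms(4) n by (intro powr_mono) auto
      then have "n powr (3 / 8) / (2 * c * ln n) \<le> n powr (1 - e') / (2 * \<tau> n)"
        using elim(2) by (intro frac_le) auto
      then show ?thesis by simp
    qed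
    finally show ?case by (simp add: add.assoc)
  qed
  then have "((\<lambda>n. f n (levels n + (C + J)) (n powr (1 - e'))) \<longlongrightarrow> 0) F"
    by (rule tendsto_sandwich[OF _ _ tendsto_const lim, rotated]) (simp add: nonneg)
  then show ?thesis unfolding good_def by blast
qed

text \<open>The exponent grows by the factor \<open>3 / 2\<close> until it meets the cap, so the
  number of jumps depends on \<open>d\<close> only.\<close>

lemma good_five_eighths: "good (5 / 8)"
proof -
  have "good (min ((3 / 2) ^ j * (d / 2)) (5 / 8))" for j
  proof (induction j)
    case 0
    have "min (d / 2) (5 / 8) = d / 2" using d by simp
    then show ?case using good_initial by simp
  next
    case (Suc j)
    show ?case by (rule good_step[OF Suc]) (use d in auto)
  qed
  moreover obtain j where "5 / 8 / (d / 2) < (3 / 2) ^ j"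
    using real_arch_pow[of "3 / 2"] by force
  then have "5 / 8 < (3 / 2) ^ j * (d / 2)" using d by (simp add: divide_less_eq)
  then have "min ((3 / 2) ^ j * (d / 2)) (5 / 8) = 5 / 8" by simp
  ultimately show ?thesis by metis
qed

text \<open>With \<open>B = n powr (3 / 8)\<close> the error \<open>8 * B\<^sup>2 / n\<close> of the
  last jump is \<open>8 * n powr (- 1 / 4)\<close>, which vanishes because \<open>5 / 8\<close>
  exceeds \<open>1 / 2\<close>.\<close>

lemma overload_tendsto_0: "\<exists>C. ((\<lambda>n. f n (levels n + C) 0) \<longlongrightarrow> 0) F"
proof -
  obtain C where C: "((\<lambda>n. f n (levels n + C) (n powr (1 - 5 / 8))) \<longlongrightarrow> 0) F"
    using good_five_eighths by (auto simp: good_def)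
  let ?b = "\<lambda>n. f n (levels n + C) (n powr (1 - 5 / 8)) + 8 * n powr (- 1 / 4)"
  have "((\<lambda>n::nat. 8 * n powr (- 1 / 4)) \<longlongrightarrow> 0) sequentially" by real_asymp
  then have lim: "(?b \<longlongrightarrow> 0) F" using tendsto_add[OF C tendsto_F] by simp
  have a1: "\<forall>\<^sub>F n::nat in sequentially. 4 * n powr (- 1 / 4) \<le> 1" by real_asymp
  have "\<forall>\<^sub>F n in F. f n (levels n + (C + J)) 0 \<le> ?b n"
    using eventually_F[OF a1] \<tau> last eventually_F[OF eventually_ge_at_top[of 1]]
  proof eventually_elim
    case (elim n)
    have n: "real n \<ge> 1" using elim(4) by simp
    have "(n powr (1 - 5 / 8))\<^sup>2 = n powr (1 + - 1 / 4)"
      by (simp add: power2_eq_square flip: powr_add)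
    also have "\<dots> = n * n powr (- 1 / 4)" using n by (simp only: powr_add) simp
    finally have "(n powr (1 - 5 / 8))\<^sup>2 / n = n powr (- 1 / 4)" using n by simp
    then show ?case
      using elim(3)[rule_format, of "n powr (1 - 5 / 8)" "levels n + C"] elim(1,2)
      by (simp add: add.assoc)
  qed
  then have "((\<lambda>n. f n (levels n + (C + J)) 0) \<longlongrightarrow> 0) F"
    by (rule tendsto_sandwich[OF _ _ tendsto_const lim, rotated]) (simp add: nonneg)
  then show ?thesis by blast
qed

end

section \<open>Choice of the parameters and conclusion\<close>

theorem theorem3:
  fixes c \<alpha> :: real and k :: nat and N :: "nat set"
    and G :: "nat \<Rightarrow> 'a pair_pre_digraph" and tie :: "nat \<Rightarrow> 'a tie_rule"
  assumes "c > 0" and "\<alpha> > 0" and "k \<ge> 3"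
    and "infinite N" and "0 \<notin> N"
    and "\<And>n. n \<in> N \<Longrightarrow> pair_graph (G n)"
    and "\<And>n. n \<in> N \<Longrightarrow> regular k (G n)"
    and "\<And>n. n \<in> N \<Longrightarrow> card (pverts (G n)) = n"
    and "\<And>n. n \<in> N \<Longrightarrow>
           enat (nat (2 * \<lceil>\<alpha> * log (real k - 1) (real n)\<rceil> + 1)) \<le> girth (G n)"
  shows "\<exists>C :: real.
    ((\<lambda>n. measure_pmf.prob (walkers (G n) (nat \<lfloor>c * ln (real n)\<rfloor>) n)
            {(w1, w2). real (max_load (G n) (tie n) w1 w2 n) \<le> log 2 (ln (real n)) + C})
       \<longlongrightarrow> 1) (inf sequentially (principal N))"
proof -
  define F where "F = inf sequentially (principal N)"
  define \<tau> where "\<tau> n = nat \<lfloor>c * ln (real n)\<rfloor>" for n :: nat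
  define g where "g n = nat \<lceil>\<alpha> * log (real k - 1) (real n)\<rceil>" for n :: nat
  \<comment> \<open>These epochs cover all \<open>n\<close> balls and overshoot by at most
    \<open>\<tau> n\<close>, giving at most \<open>2 * n\<close> steps for large
    \<open>n\<close>.\<close>
  define s where "s n = n div \<tau> n + 1" for n
  \<comment> \<open>\<open>3 * d\<close> is at most \<open>\<alpha>\<close> and at most 1, so
    \<open>1 / real (k - 1) ^ g n\<close> and \<open>1 / n\<close> are both at most
    \<open>n powr (- 3 * d)\<close>. The mean number of collision times is then of order at most
    \<open>n powr (1 - 3 * d) * ln n\<close>, which fits into the budget
    \<open>n powr (1 - d)\<close>.\<close>
  define d where "d = min \<alpha> 1 / 3"
  \<comment> \<open>The quotient of \<open>\<tau> n\<close> and \<open>g n\<close> is at most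
    \<open>c * ln n / (\<alpha> * log (real k - 1) n) = c * ln (real k - 1) / \<alpha>\<close>, free
    of \<open>n\<close>. The final \<open>+ 1\<close> makes the inequality for \<open>J\<close>
    strict.\<close>
  define J where "J = 2 * (nat \<lfloor>c * ln (real k - 1) / \<alpha>\<rfloor> + 1) + 1"
  \<comment> \<open>The default 0 outside \<open>N\<close> lets nonnegativity and monotonicity hold
    for every \<open>n\<close>.\<close>
  define f where "f n i B = (if n \<in> N
    then regular_girth_graph.overload (G n) (tie n) (\<tau> n) (s n) i B else 0)" for n i B
  have k1: "real k - 1 > 1" and k1_eq: "real (k - 1) = real k - 1"
    using assms(3) by (auto simp: of_nat_diff)
  have lnk: "ln (real k - 1) > 0" using k1 by simp
  have d: "0 < d" "d \<le> 1 / 3" using assms(2) by (auto simp: d_def)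
  have graph: "regular_girth_graph (G n) k (g n)" if n: "n \<in> N" for n
  proof -
    have "n \<ge> 1" using n assms(5) by (cases n) auto
    then have "0 \<le> \<alpha> * log (real k - 1) n" using k1 assms(2) by simp
    then have "nat (2 * \<lceil>\<alpha> * log (real k - 1) (real n)\<rceil> + 1) = 2 * g n + 1"
      unfolding g_def by linarith
    then have "enat (2 * g n + 1) \<le> girth (G n)" using assms(9)[OF n] by simp
    moreover have "pverts (G n) \<noteq> {}" using assms(8)[OF n] \<open>n \<ge> 1\<close> by auto
    ultimately show ?thesis
      using assms(3) assms(6,7)[OF n]
      by (simp add: regular_girth_graph_def regular_girth_graph_axioms_def)
  qed
  have ev: "\<forall>\<^sub>F n in F. P n" if "\<forall>\<^sub>F n in sequentially. n \<in> N \<longrightarrow> P n" for P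
    using that by (simp add: F_def eventually_inf_principal)
  have large: "\<forall>\<^sub>F n in F. n \<in> N \<and> n \<ge> 2 \<and> 0 < \<tau> n \<and> 1 \<le> real (\<tau> n) \<and> real (\<tau> n) \<le> c * ln n \<and>
      real (s n * \<tau> n) \<le> 2 * real n \<and> n \<le> s n * \<tau> n \<and> 0 < g n \<and> 2 * (\<tau> n div g n + 1) < J \<and>
      8 * real n * (2 * real (\<tau> n) * (1 / real (k - 1) ^ g n + 1 / n)) \<le> n powr (1 - d)"
  proof (rule ev)
    have e1: "\<forall>\<^sub>F n::nat in sequentially. 1 \<le> c * ln n" using assms(1) by real_asymp
    have e2: "\<forall>\<^sub>F n::nat in sequentially. c * ln n \<le> n" using assms(1) by real_asymp
    have e3: "\<forall>\<^sub>F n::nat in sequentially. 32 * (c * ln n) * n powr (1 - 3 * d) \<le> n powr (1 - d)"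
      using assms(1) d(1) by real_asymp
    show "\<forall>\<^sub>F n in sequentially. n \<in> N \<longrightarrow>
      n \<in> N \<and> n \<ge> 2 \<and> 0 < \<tau> n \<and> 1 \<le> real (\<tau> n) \<and> real (\<tau> n) \<le> c * ln n \<and>
      real (s n * \<tau> n) \<le> 2 * real n \<and> n \<le> s n * \<tau> n \<and> 0 < g n \<and> 2 * (\<tau> n div g n + 1) < J \<and>
      8 * real n * (2 * real (\<tau> n) * (1 / real (k - 1) ^ g n + 1 / n)) \<le> n powr (1 - d)"
      using e1 e2 e3 eventually_ge_at_top[of 2]
    proof eventually_elim
      case (elim n)
      have n: "real n \<ge> 2" using elim(4) by simp
      have \<tau>1: "0 < \<tau> n" using elim(1) unfolding \<tau>_def by linarith
      have \<tau>c: "real (\<tau> n) \<le> c * ln n" using elim(1) unfolding \<tau>_def by linarith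
      then have \<tau>n: "\<tau> n \<le> n" using elim(2) by linarith
      have s: "s n * \<tau> n = n div \<tau> n * \<tau> n + \<tau> n" by (simp add: s_def)
      have "n div \<tau> n * \<tau> n \<le> n" by simp
      then have s1: "s n * \<tau> n \<le> 2 * n" using s \<tau>n by linarith
      have s2: "n \<le> s n * \<tau> n"
        unfolding s using dividend_less_div_times[OF \<tau>1, of n] by linarith
      have log: "log (real k - 1) n > 0" using k1 n by simp
      then have gpos: "0 < \<alpha> * log (real k - 1) n" using assms(2) by simp
      have g_ge: "\<alpha> * log (real k - 1) n \<le> real (g n)" unfolding g_def by linarith
      then have g0: "0 < g n" using gpos by (cases "g n") auto
      have "real (\<tau> n div g n) \<le> real (\<tau> n) / real (g n)" by (rule of_nat_div_le_of_nat)
      also have "\<dots> \<le> c * ln n / (\<alpha> * log (real k - 1) n)"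
        using \<tau>c gpos g_ge elim(1) by (intro frac_le) auto
      also have "\<dots> = c * ln (real k - 1) / \<alpha>"
        using n lnk assms(2) by (simp add: log_def)
      finally have "\<tau> n div g n \<le> nat \<lfloor>c * ln (real k - 1) / \<alpha>\<rfloor>" by linarith
      then have J: "2 * (\<tau> n div g n + 1) < J" by (simp add: J_def)
      \<comment> \<open>The logarithmic girth makes the return probability polynomially small:
        \<open>real (k - 1) ^ g n\<close> is at least \<open>n powr \<alpha>\<close>.\<close>
      have "n powr \<alpha> = (real k - 1) powr (\<alpha> * log (real k - 1) n)"
        using lnk k1 n by (simp add: powr_def log_def)
      also have "\<dots> \<le> (real k - 1) powr real (g n)" using g_ge k1 by simp
      also have "\<dots> = real (k - 1) ^ g n" using k1 k1_eq by (simp add: powr_realpow)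
      finally have "1 / real (k - 1) ^ g n \<le> 1 / n powr \<alpha>"
        using n by (intro frac_le) auto
      also have "\<dots> = n powr - \<alpha>" by (simp add: powr_minus divide_inverse)
      also have "\<dots> \<le> n powr (- 3 * d)" using n by (intro powr_mono) (auto simp: d_def)
      finally have h1: "1 / real (k - 1) ^ g n \<le> n powr (- 3 * d)" .
      have "1 / real n = n powr - 1" using n by (simp add: powr_minus divide_inverse)
      also have "\<dots> \<le> n powr (- 3 * d)" using n by (intro powr_mono) (auto simp: d_def)
      finally have h2: "1 / real n \<le> n powr (- 3 * d)" .
      have "8 * real n * (2 * real (\<tau> n) * (1 / real (k - 1) ^ g n + 1 / n))
          \<le> 8 * real n * (2 * (c * ln n) * (n powr (- 3 * d) + n powr (- 3 * d)))"
        using h1 h2 \<tau>c elim(1) by (intro mult_mono add_mono) auto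
      also have "\<dots> = 32 * (c * ln n) * (n * n powr (- 3 * d))" by simp
      also have "n * n powr (- 3 * d) = n powr (1 - 3 * d)" using n by (simp add: powr_mult_base)
      also have "32 * (c * ln n) * n powr (1 - 3 * d) \<le> n powr (1 - d)" by (rule elim(3))
      finally show ?case
        using elim(4) \<tau>1 \<tau>c s1 s2 g0 J by (simp flip: of_nat_mult)
    qed
  qed
  interpret layered_tail f "\<lambda>n. real (\<tau> n)" F c d J
  proof
    show "F \<le> sequentially" by (simp add: F_def)
    show "0 < d" "d \<le> 1 / 3" "c > 0" using d assms(1) by auto
    show "0 \<le> f n i B" for n i B
      by (simp add: f_def regular_girth_graph.overload_def[OF graph])
    show "f n i B' \<le> f n i B" if "B \<le> B'" for n i B B'
      using that by (simp add: f_def regular_girth_graph.overload_antimono[OF graph])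
    show "\<forall>\<^sub>F n in F. 1 \<le> real (\<tau> n) \<and> real (\<tau> n) \<le> c * ln n"
      using large by eventually_elim simp
    show "\<forall>\<^sub>F n in F. f n 64 (n / 32) = 0"
      using large
    proof eventually_elim
      case (elim n)
      then interpret regular_girth_graph "G n" k "g n" using graph by blast
      show ?case using elim overload_initial[of "s n" "\<tau> n" 64 "n / 32"] by (simp add: f_def)
    qed
    show "\<forall>\<^sub>F n in F. \<forall>i B y. 0 < y \<longrightarrow> 8 * B\<^sup>2 / n \<le> y \<longrightarrow> f n (Suc i) (y + n powr (1 - d))
        \<le> f n i B + exp (- y / (2 * real (\<tau> n))) + exp (- (n powr (1 - d)) / (2 * real (\<tau> n)))"
      using large
    proof eventually_elim
      case (elim n)
      then interpret regular_girth_graph "G n" k "g n" using graph by blast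
      have "card (pverts (G n)) = n" using elim assms(8) by blast
      then show ?case
        using elim overload_Suc[of "\<tau> n" "s n"] by (simp add: f_def)
    qed
    show "\<forall>\<^sub>F n in F. \<forall>i B y. 0 < y \<longrightarrow> 8 * B\<^sup>2 / n \<le> y \<longrightarrow>
        f n (i + J) y \<le> f n i B + exp (- y / (2 * real (\<tau> n)))"
      using large
    proof eventually_elim
      case (elim n)
      then interpret regular_girth_graph "G n" k "g n" using graph by blast
      have "card (pverts (G n)) = n" using elim assms(8) by blast
      then show ?case
        using elim overload_jump[of "\<tau> n" J "s n"] by (simp add: f_def)
    qed
    show "\<forall>\<^sub>F n in F. \<forall>i B. 4 * B\<^sup>2 / n \<le> real (\<tau> n) \<longrightarrow>
        f n (i + J) 0 \<le> f n i B + 8 * B\<^sup>2 / n"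
      using large
    proof eventually_elim
      case (elim n)
      then interpret regular_girth_graph "G n" k "g n" using graph by blast
      have "card (pverts (G n)) = n" using elim assms(8) by blast
      then show ?case
        using elim overload_last[of "\<tau> n" J "s n"] by (simp add: f_def)
    qed
  qed
  obtain C where C: "((\<lambda>n. f n (levels n + C) 0) \<longlongrightarrow> 0) F"
    using overload_tendsto_0 by blast
  let ?p = "\<lambda>n. measure_pmf.prob (walkers (G n) (nat \<lfloor>c * ln (real n)\<rfloor>) n)
    {(w1, w2). real (max_load (G n) (tie n) w1 w2 n) \<le> log 2 (ln (real n)) + (real C + 1)}"
  have lower: "((\<lambda>n. 1 - f n (levels n + C) 0) \<longlongrightarrow> 1) F"
    using tendsto_diff[OF tendsto_const C, of 1] by simp
  have e4: "\<forall>\<^sub>F n::nat in sequentially. 1 \<le> ln n" by real_asymp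
  have "\<forall>\<^sub>F n in F. 1 - f n (levels n + C) 0 \<le> ?p n"
    using large eventually_F[OF e4]
  proof eventually_elim
    case (elim n)
    then interpret regular_girth_graph "G n" k "g n" using graph by blast
    \<comment> \<open>For a nonnegative logarithm \<open>nat\<close> does not truncate, and rounding
      up costs at most 1; hence the constant \<open>real C + 1\<close>.\<close>
    have "0 \<le> log 2 (ln n)" using elim(2) by simp
    then have "real (levels n + C) \<le> log 2 (ln n) + (real C + 1)"
      unfolding levels_def by linarith
    then have "1 - overload (tie n) (\<tau> n) (s n) (levels n + C) 0
        \<le> measure_pmf.prob (walkers (G n) (\<tau> n) n)
          {(w1, w2). real (max_load (G n) (tie n) w1 w2 n) \<le> log 2 (ln n) + (real C + 1)}"
      using elim(1) by (intro prob_max_load_le) auto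
    then show ?case using elim(1) by (simp add: f_def \<tau>_def)
  qed
  then have "(?p \<longlongrightarrow> 1) F"
    by (rule tendsto_sandwich[OF _ _ lower tendsto_const]) simp
  then show ?thesis unfolding F_def by blast
qed

end
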